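(* For any $\mathscr{B}\subset\mathbb{N}$, we have $h_{top}(S,\widetilde{X}_\eta)=h_{top}(S,X_{\mathscr{B}})=\boldsymbol{\delta}(\mathcal{F}_{\mathscr{B}})$.
   Context: $\mathbb{N}=\{1,2,\dots\}$. For $\mathscr{B}\subset\mathbb{N}$ let $\mathcal{F}_{\mathscr{B}}:=\mathbb{Z}\setminus\bigcup_{b\in\mathscr{B}}b\mathbb{Z}$; $\eta\in\{0,1\}^{\mathbb{Z}}$ is the characteristic function of $\mathcal{F}_{\mathscr{B}}$. $S$ is the left shift on $\{0,1\}^{\mathbb{Z}}$ (product topology), and $X_\eta$ is the closure of $\{S^m\eta : m\in\mathbb{Z}\}$. A subshift $X\subset\{0,1\}^{\mathbb{Z}}$ (closed, $S$-invariant set) is hereditary if $x\in X$ and $y\le x$ coordinatewise imply $y\in X$; $\widetilde{X}_\eta$ is the smallest hereditary subshift containing $X_\eta$. With $\operatorname{supp}x:=\{n\in\mathbb{Z}: x(n)=1\}$, $X_{\mathscr{B}}:=\{x\in\{0,1\}^{\mathbb{Z}} : |\operatorname{supp}x\bmod b|<b\text{ for each }b\in\mathscr{B}\}$ (the $\mathscr{B}$-admissible subshift), where $\operatorname{supp}x\bmod b$ is the image of $\operatorname{supp}x$ in $\mathbb{Z}/b\mathbb{Z}$. Topological entropy $h_{top}$ of a subshift is $\lim_{n\to\infty}\frac1n\log_2 p(n)$, where $p(n)$ is the number of blocks of length $n$ appearing in the subshift (logarithm to base $2$). The logarithmic density of $A\subset\mathbb{Z}$ is $\boldsymbol{\delta}(A)=\lim_{N\to\infty}\frac{1}{\log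 N}\sum_{a\in A,1\le a\le N}\frac1a$ when the limit exists; it always exists for $A=\mathcal{F}_{\mathscr{B}}$ (Davenport–Erdős). *)

theory Defs
  imports "HOL-Analysis.Analysis"
begin

text \<open>
  The space of two-sided 0-1 sequences is represented by the type \<^typ>\<open>int \<Rightarrow> bool\<close>,
  with \<^term>\<open>False\<close> for 0 and \<^term>\<open>True\<close> for 1. Its library topology is
  the product of the discrete topologies and its library order is the coordinatewise one.
\<close>

type_synonym bseq = "int \<Rightarrow> bool"

definition supp :: "bseq \<Rightarrow> int set" where
  "supp x = {n. x n}"

definition shift :: "bseq \<Rightarrow> bseq" where
  "shift x = (\<lambda>n. x (n + 1))"

definition shift_pow :: "int \<Rightarrow> bseq \<Rightarrow> bseq" where
  "shift_pow m x = (\<lambda>n. x (n + m))"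

definition subshift :: "bseq set \<Rightarrow> bool" where
  "subshift X \<longleftrightarrow> closed X \<and> shift ` X = X"

definition hereditary :: "bseq set \<Rightarrow> bool" where
  "hereditary X \<longleftrightarrow> (\<forall>x\<in>X. \<forall>y. y \<le> x \<longrightarrow> y \<in> X)"

definition orbit_closure :: "bseq \<Rightarrow> bseq set" where
  "orbit_closure x = closure (range (\<lambda>m. shift_pow m x))"

text \<open>
  The smallest hereditary subshift containing a set; that the intersection is itself
  a hereditary subshift is proved below.
\<close>

definition hereditary_closure :: "bseq set \<Rightarrow> bseq set" where
  "hereditary_closure X = \<Inter>{Y. subshift Y \<and> hereditary Y \<and> X \<subseteq> Y}"

definition free_set :: "nat set \<Rightarrow> int set" where
  "free_set B = UNIV - (\<Union>b\<in>B. range (\<lambda>k. int b * k))"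

definition eta :: "nat set \<Rightarrow> bseq" where
  "eta B = (\<lambda>n. n \<in> free_set B)"

definition X_eta :: "nat set \<Rightarrow> bseq set" where
  "X_eta B = orbit_closure (eta B)"

definition X_eta_hered :: "nat set \<Rightarrow> bseq set" where
  "X_eta_hered B = hereditary_closure (X_eta B)"

text \<open>Residue classes modulo \<open>b > 0\<close> are represented by their elements in \<open>{0..<b}\<close>.\<close>

definition admissible_shift :: "nat set \<Rightarrow> bseq set" where
  "admissible_shift B = {x. \<forall>b\<in>B. card ((\<lambda>n. n mod int b) ` supp x) < b}"

definition blocks :: "nat \<Rightarrow> bseq set \<Rightarrow> bool list set" where
  "blocks n X = {map (\<lambda>i. x (k + int i)) [0..<n] | x k. x \<in> X}"

definition entropy_seq :: "bseq set \<Rightarrow> nat \<Rightarrow> real" where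
  "entropy_seq X n = log 2 (real (card (blocks n X))) / real n"

definition top_entropy :: "bseq set \<Rightarrow> real" where
  "top_entropy X = lim (entropy_seq X)"

definition log_density_seq :: "int set \<Rightarrow> nat \<Rightarrow> real" where
  "log_density_seq A N =
     (\<Sum>a | a \<in> A \<and> 1 \<le> a \<and> a \<le> int N. 1 / real_of_int a) / ln (real N)"

definition log_density :: "int set \<Rightarrow> real" where
  "log_density A = lim (log_density_seq A)"

lemma shift_pow_of_nat: "shift_pow (int k) = shift ^^ k"
proof (induction k)
  case 0
  show ?case by (simp add: shift_pow_def fun_eq_iff)
next
  case (Suc k)
  have "shift_pow (int (Suc k)) = shift \<circ> shift_pow (int k)"
    by (simp add: shift_pow_def shift_def fun_eq_iff ac_simps)
  then show ?case by (simp add: Suc)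
qed

lemma bij_shift: "bij shift"
proof (rule o_bij)
  show "shift_pow (-1) \<circ> shift = id" "shift \<circ> shift_pow (-1) = id"
    by (simp_all add: shift_pow_def shift_def fun_eq_iff)
qed

lemma shift_pow_minus_of_nat: "shift_pow (- int k) = inv shift ^^ k"
proof (induction k)
  case 0
  show ?case by (simp add: shift_pow_def fun_eq_iff)
next
  case (Suc k)
  have "inv shift = shift_pow (-1)"
    by (rule inv_unique_comp) (simp_all add: shift_pow_def shift_def fun_eq_iff)
  moreover have "shift_pow (- int (Suc k)) = shift_pow (-1) \<circ> shift_pow (- int k)"
    by (simp add: shift_pow_def fun_eq_iff algebra_simps)
  ultimately show ?case by (simp add: Suc)
qed

lemma subset_hereditary_closure: "X \<subseteq> hereditary_closure X"
  by (auto simp: hereditary_closure_def)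

lemma hereditary_hereditary_closure: "hereditary (hereditary_closure X)"
  unfolding hereditary_closure_def hereditary_def by blast

lemma subshift_hereditary_closure: "subshift (hereditary_closure X)"
proof -
  let ?F = "{Y. subshift Y \<and> hereditary Y \<and> X \<subseteq> Y}"
  have "closed (\<Inter>?F)"
    by (rule closed_Inter) (auto simp: subshift_def)
  moreover have "?F \<noteq> {}"
    using bij_shift by (auto simp: subshift_def hereditary_def bij_def intro!: exI[of _ UNIV])
  then have "shift ` (\<Inter>?F) = (\<Inter>Y\<in>?F. shift ` Y)"
    using bij_image_INT[OF bij_shift, of "\<lambda>Y. Y" ?F] by simp
  then have "shift ` (\<Inter>?F) = \<Inter>?F"
    by (simp add: subshift_def)
  ultimately show ?thesis
    by (simp add: subshift_def hereditary_closure_def)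
qed

lemma hereditary_closure_least:
  assumes "subshift Y" "hereditary Y" "X \<subseteq> Y"
  shows "hereditary_closure X \<subseteq> Y"
  using assms by (auto simp: hereditary_closure_def)

end

theory Submission
  imports Defs "HOL-Number_Theory.Cong"
begin

text \<open>
  For \<open>K\<close> a natural number, the elements of \<open>B\<close> up to \<open>K\<close> form a finite set, whose free set is
  periodic and has a density \<open>d K\<close>. All three quantities of the theorem equal \<open>D = INF K. d K\<close>.

  The logarithmic density is \<open>D\<close> (Davenport and Erdos, theorem \<open>davenport_erdos\<close>). It is at most
  every \<open>d K\<close> since the free set of \<open>B\<close> is contained in that of the truncation. For the other
  inequality, the integers lost when passing from the truncation to \<open>B\<close> have to be logarithmically
  rare. Here weights \<open>n powr (- s)\<close> with \<open>s > 1\<close> help: the share of a set closed under multiples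
  increases as \<open>s\<close> decreases to 1 (\<open>multiples_weight_comparison\<close>), so for every \<open>s\<close> the share of the
  multiples of \<open>B\<close> is at most \<open>1 - D\<close>, whereas the multiples of the truncation have share
  \<open>1 - d K\<close> as \<open>s\<close> tends to 1. With \<open>s = 1 + 1 / ln N\<close> this bounds the sum of \<open>1/n\<close> over the lost
  integers \<open>n \<le> N\<close> by a constant times \<open>(d K - D) * ln N\<close>.

  For the entropies, every hereditary set that contains \<open>eta B\<close> has at least \<open>2\<close> to the number of
  free integers in \<open>[1, N]\<close> blocks of length \<open>N\<close>; together with submultiplicativity of block numbers
  this gives the lower bound \<open>D\<close> (\<open>limit_density_le_entropy_seq\<close>). For the upper bound \<open>d K\<close>, an
  admissible point avoids one residue class for each modulus in the truncation. By Rogers' theorem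
  (\<open>rogers\<close>), the density of the integers avoiding such classes is largest when all the classes are
  those of 0, where it is \<open>d K\<close>, and there are only finitely many choices of classes
  (\<open>card_blocks_admissible\<close>). Since the hereditary closure of \<open>X_eta B\<close> contains \<open>eta B\<close> and lies in
  the admissible subshift, both bounds apply to both subshifts.
\<close>

section \<open>Weighted counting sums\<close>

definition power_sum :: "real \<Rightarrow> nat \<Rightarrow> real" where
  "power_sum s N = (\<Sum>i=1..N. real i powr (- s))"

text \<open>
  For \<open>s > 1\<close> this is a partial sum of the Dirichlet series of the indicator of \<open>A\<close>; for
  \<open>s = 1\<close> it is the numerator of the logarithmic density. Treating both as one function of \<open>s\<close>
  lets the proof move between the two.
\<close>

definition restricted_power_sum :: "int set \<Rightarrow> real \<Rightarrow> nat \<Rightarrow> real" where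
  "restricted_power_sum A s N = (\<Sum>i=1..N. of_bool (int i \<in> A) * real i powr (- s))"

definition count_upto :: "int set \<Rightarrow> nat \<Rightarrow> real" where
  "count_upto A N = (\<Sum>i=1..N. of_bool (int i \<in> A))"

text \<open>
  Summation by parts: with a decreasing weight the factors \<open>w i - w (i + 1)\<close> are nonnegative and
  telescope to at most \<open>w 1\<close>. Applied to the indicator of a set minus its density, it turns a
  counting estimate with bounded error into an estimate for all weights \<open>i powr (- s)\<close> at once,
  with the same error.
\<close>

lemma abel_summation_bound:
  fixes f w :: "nat \<Rightarrow> real"
  assumes partial: "\<And>m. m \<le> N \<Longrightarrow> (\<Sum>i=1..m. f i) \<le> C"
    and dec: "\<And>i. 1 \<le> i \<Longrightarrow> w (Suc i) \<le> w i"
    and nonneg: "\<And>i. 1 \<le> i \<Longrightarrow> 0 \<le> w i"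
  shows "(\<Sum>i=1..N. f i * w i) \<le> C * w 1"
proof (cases "N = 0")
  case True
  then show ?thesis using partial[of 0] nonneg[of 1] by simp
next
  case False
  define S where "S m = (\<Sum>i=1..m. f i)" for m
  have S: "S m \<le> C" if "m \<le> N" for m
    using partial[OF that] by (simp add: S_def)
  have "1 \<le> m \<Longrightarrow> m \<le> N \<Longrightarrow> (\<Sum>i=1..m. f i * w i) \<le> S m * w m + C * (w 1 - w m)" for m
  proof (induction m rule: nat_induct_at_least)
    case base
    show ?case by (simp add: S_def)
  next
    case (Suc m)
    have IH: "(\<Sum>i=1..m. f i * w i) \<le> S m * w m + C * (w 1 - w m)"
      using Suc by simp
    have "S m * (w m - w (Suc m)) \<le> C * (w m - w (Suc m))"
      using S[of m] dec[of m] Suc by (intro mult_right_mono) auto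
    moreover have "S (Suc m) = S m + f (Suc m)"
      by (simp add: S_def)
    ultimately show ?case
      using IH by (simp add: algebra_simps)
  qed
  from this[of N] have "(\<Sum>i=1..N. f i * w i) \<le> S N * w N + C * (w 1 - w N)"
    using False by simp
  also have "S N * w N \<le> C * w N"
    using S[of N] nonneg[of N] False by (intro mult_right_mono) auto
  finally show ?thesis by (simp add: algebra_simps)
qed

lemma powr_minus_decreasing:
  assumes "0 \<le> s" "1 \<le> i"
  shows "real (Suc i) powr (- s) \<le> real i powr (- s)"
  using assms by (intro powr_mono2') auto

lemma restricted_power_sum_le:
  assumes "\<And>m. count_upto A m \<le> d * real m + C" "0 \<le> s"
  shows "restricted_power_sum A s N \<le> d * power_sum s N + C"
proof -
  have "(\<Sum>i=1..N. (of_bool (int i \<in> A) - d) * real i powr (- s)) \<le> C * real 1 powr (- s)"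
  proof (rule abel_summation_bound)
    fix m
    show "(\<Sum>i=1..m. of_bool (int i \<in> A) - d) \<le> C"
      using assms(1)[of m] by (simp add: count_upto_def sum_subtractf algebra_simps)
  qed (use assms(2) powr_minus_decreasing[of s] in auto)
  then show ?thesis
    by (simp add: restricted_power_sum_def power_sum_def sum_subtractf left_diff_distrib
        sum_distrib_left)
qed

lemma restricted_power_sum_Compl:
  "restricted_power_sum (- A) s N = power_sum s N - restricted_power_sum A s N"
  unfolding restricted_power_sum_def power_sum_def sum_subtractf[symmetric]
  by (intro sum.cong) auto

lemma count_upto_Compl: "count_upto (- A) N = real N - count_upto A N"
proof -
  have "count_upto (- A) N = (\<Sum>i=1..N. 1 - of_bool (int i \<in> A))"
    unfolding count_upto_def by (intro sum.cong) auto
  then show ?thesis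
    by (simp add: sum_subtractf count_upto_def)
qed

lemma restricted_power_sum_ge:
  assumes "\<And>m. d * real m - C \<le> count_upto A m" "0 \<le> s"
  shows "d * power_sum s N - C \<le> restricted_power_sum A s N"
proof -
  have "restricted_power_sum (- A) s N \<le> (1 - d) * power_sum s N + C"
  proof (rule restricted_power_sum_le)
    fix m
    show "count_upto (- A) m \<le> (1 - d) * real m + C"
      using assms(1)[of m] by (simp add: count_upto_Compl algebra_simps)
  qed fact
  then show ?thesis
    by (simp add: restricted_power_sum_Compl algebra_simps)
qed

lemma count_upto_mono_set: "A \<subseteq> A' \<Longrightarrow> count_upto A N \<le> count_upto A' N"
  unfolding count_upto_def by (intro sum_mono) auto

lemma restricted_power_sum_mono:
  "N \<le> N' \<Longrightarrow> restricted_power_sum A s N \<le> restricted_power_sum A s N'"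
  unfolding restricted_power_sum_def by (intro sum_mono2) auto

lemma restricted_power_sum_Diff:
  assumes "A \<subseteq> A'"
  shows "restricted_power_sum (A' - A) s N = restricted_power_sum A' s N - restricted_power_sum A s N"
  unfolding restricted_power_sum_def sum_subtractf[symmetric]
  using assms by (intro sum.cong) auto

lemma power_sum_1: "power_sum 1 N = harm N"
  unfolding power_sum_def harm_def by (intro sum.cong) (auto simp: powr_minus powr_one)

lemma log_density_seq_eq: "log_density_seq A N = restricted_power_sum A 1 N / ln (real N)"
proof -
  have "(\<Sum>a | a \<in> A \<and> 1 \<le> a \<and> a \<le> int N. 1 / real_of_int a) =
      (\<Sum>i | i \<in> {1..N} \<and> int i \<in> A. 1 / real i)"
    by (rule sum.reindex_bij_witness[of _ int nat]) auto
  also have "\<dots> = restricted_power_sum A 1 N"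
    unfolding restricted_power_sum_def
    by (intro sum.mono_neutral_cong_left) (auto simp: powr_minus powr_one field_simps)
  finally show ?thesis
    by (simp add: log_density_seq_def)
qed

lemma harm_le_ln:
  assumes "1 \<le> n"
  shows "harm n \<le> ln (real n) + (1::real)"
proof -
  obtain m where m: "n = Suc m" using assms by (cases n) auto
  have "harm (Suc m) - ln (real (Suc m)) \<le> harm (Suc 0) - ln (real (Suc 0))"
    using decseqD[OF decseq_harm_diff_ln, of 0 m] by simp
  then show ?thesis
    by (simp add: m harm_expand)
qed

text \<open>
  The terms between \<open>n\<close> and \<open>k n\<close> contribute a bounded amount, so stretching the range by a fixed
  factor is invisible after division by \<open>harm n\<close>.
\<close>

lemma harm_mult_le: "harm (k * n) \<le> harm n + real k"
proof (cases "n = 0 \<or> k = 0")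
  case False
  have split: "{1..k * n} = {1..n} \<union> {n<..k * n}"
    using False le_trans[of _ n "k * n"] by auto
  then have "harm (k * n) = (harm n :: real) + (\<Sum>i\<in>{n<..k * n}. inverse (real i))"
    unfolding harm_def split by (subst sum.union_disjoint) auto
  also have "(\<Sum>i\<in>{n<..k * n}. inverse (real i)) \<le> (\<Sum>i\<in>{n<..k * n}. inverse (real n))"
    using False by (intro sum_mono) auto
  also have "\<dots> \<le> real (k * n) * inverse (real n)"
    by (simp only: sum_constant card_greaterThanAtMost)
      (intro mult_right_mono, simp_all del: of_nat_mult)
  also have "\<dots> = real k" using False by simp
  finally show ?thesis by simp
qed (auto simp: harm_expand harm_nonneg)

lemma log_density_seq_le:
  assumes "\<And>m. count_upto A m \<le> d * real m + C" "0 \<le> d" "2 \<le> N"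
  shows "log_density_seq A N \<le> d + (d + C) / ln (real N)"
proof -
  have "restricted_power_sum A 1 N \<le> d * harm N + C"
    using restricted_power_sum_le[OF assms(1), of 1 N] by (simp add: power_sum_1)
  also have "\<dots> \<le> d * (ln (real N) + 1) + C"
    using assms harm_le_ln[of N] by (intro add_right_mono mult_left_mono) auto
  finally have "log_density_seq A N \<le> (d * (ln (real N) + 1) + C) / ln (real N)"
    unfolding log_density_seq_eq using assms by (intro divide_right_mono) auto
  also have "\<dots> = d + (d + C) / ln (real N)"
    using assms by (simp add: field_simps)
  finally show ?thesis .
qed

lemma divide_ln_tendsto_0: "(\<lambda>N. C / ln (real N)) \<longlonglongrightarrow> 0"
proof -
  have "filterlim (\<lambda>N. ln (real N)) at_top sequentially"
    by (rule filterlim_compose[OF ln_at_top filterlim_real_sequentially])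
  then show ?thesis
    by (intro tendsto_divide_0[OF tendsto_const] filterlim_at_top_imp_at_infinity)
qed

text \<open>
  Compare the term at \<open>n + 1\<close> with the telescoping difference of \<open>n powr (1 - s) / (s - 1)\<close>;
  the comparison comes from \<open>ln (1 + 1/n) \<ge> 1/(n+1)\<close>.
\<close>

lemma power_sum_le:
  assumes s: "1 < s"
  shows "power_sum s N \<le> 1 + 1 / (s - 1)"
proof (cases "N = 0")
  case True
  then show ?thesis using s by (simp add: power_sum_def)
next
  case False
  define t where "t = s - 1"
  have t: "0 < t" using s by (simp add: t_def)
  have step: "real (Suc n) powr (- s) \<le> (real n powr (- t) - real (Suc n) powr (- t)) / t"
    if n: "1 \<le> n" for n
  proof -
    have "ln (real (Suc n)) - ln (real n) \<ge> 1 / real (Suc n)"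
    proof -
      have "ln (real n / real (Suc n)) \<le> real n / real (Suc n) - 1"
        using n by (intro ln_le_minus_one) auto
      then show ?thesis using n by (simp add: ln_div field_simps)
    qed
    then have "t * (1 / real (Suc n)) \<le> t * (ln (real (Suc n)) - ln (real n))"
      using t by (intro mult_left_mono) auto
    also have "\<dots> \<le> exp (t * (ln (real (Suc n)) - ln (real n))) - 1"
      using exp_ge_add_one_self[of "t * (ln (real (Suc n)) - ln (real n))"] by linarith
    finally have "real (Suc n) powr (- t) * (t * (1 / real (Suc n))) \<le>
        real (Suc n) powr (- t) * (exp (t * (ln (real (Suc n)) - ln (real n))) - 1)"
      by (intro mult_left_mono) auto
    also have "\<dots> = real n powr (- t) - real (Suc n) powr (- t)"
      using n by (simp add: powr_def right_diff_distrib exp_add[symmetric] algebra_simps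
          del: of_nat_Suc)
    finally have "real (Suc n) powr (- t) / real (Suc n) \<le>
        (real n powr (- t) - real (Suc n) powr (- t)) / t"
      using t by (simp add: field_simps)
    moreover have "real (Suc n) powr (- s) = real (Suc n) powr (- t) / real (Suc n)"
      using powr_diff[of "real (Suc n)" "- t" 1] by (simp add: t_def powr_one)
    ultimately show ?thesis by simp
  qed
  have "1 \<le> N \<Longrightarrow> power_sum s N \<le> 1 + (1 - real N powr (- t)) / t"
  proof (induction N rule: nat_induct_at_least)
    case base
    show ?case by (simp add: power_sum_def)
  next
    case (Suc n)
    then show ?case
      using step[of n] by (simp add: power_sum_def diff_divide_distrib)
  qed
  then have "power_sum s N \<le> 1 + (1 - real N powr (- t)) / t"
    using False by simp
  also have "\<dots> \<le> 1 + 1 / t"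
    using t by (simp add: field_simps)
  finally show ?thesis by (simp add: t_def)
qed

text \<open>
  The Riemann zeta function on \<open>s > 1\<close>; the partial sums increase, so their supremum is their
  limit.
\<close>

definition zeta_value :: "real \<Rightarrow> real" where
  "zeta_value s = (SUP N. power_sum s N)"

lemma
  assumes s: "1 < s"
  shows power_sum_le_zeta: "power_sum s N \<le> zeta_value s"
    and power_sum_tendsto_zeta: "power_sum s \<longlonglongrightarrow> zeta_value s"
    and zeta_value_le: "zeta_value s \<le> 1 + 1 / (s - 1)"
    and zeta_value_nonneg: "0 \<le> zeta_value s"
proof -
  have bdd: "bdd_above (range (power_sum s))"
    using power_sum_le[OF s] by (intro bdd_aboveI2)
  have inc: "incseq (power_sum s)"
    unfolding power_sum_def by (intro monoI sum_mono2) auto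
  show le: "power_sum s N \<le> zeta_value s" for N
    unfolding zeta_value_def by (intro cSUP_upper bdd) auto
  show "power_sum s \<longlonglongrightarrow> zeta_value s"
    unfolding zeta_value_def by (intro LIMSEQ_incseq_SUP bdd inc)
  show "zeta_value s \<le> 1 + 1 / (s - 1)"
    unfolding zeta_value_def by (intro cSUP_least power_sum_le[OF s]) auto
  show "0 \<le> zeta_value s"
    using le[of 0] by (simp add: power_sum_def)
qed

section \<open>Periodic sets\<close>

text \<open>
  Each full period contributes exactly \<open>C\<close>, and \<open>{..<n}\<close> lies between two consecutive whole
  numbers of periods.
\<close>

lemma periodic_sum_bounds:
  fixes f :: "nat \<Rightarrow> real"
  assumes per: "\<And>i. f (i + L) = f i" and nonneg: "\<And>i. 0 \<le> f i" and L: "0 < L"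
  defines "C \<equiv> \<Sum>i<L. f i"
  shows "(\<Sum>i<n. f i) \<le> C * (real n / real L + 1)"
    and "C * (real n / real L - 1) \<le> (\<Sum>i<n. f i)"
proof -
  have per': "f (i + q * L) = f i" for i q
  proof (induction q)
    case (Suc q)
    then show ?case using per[of "i + q * L"] by (simp add: algebra_simps)
  qed simp
  have block: "sum f {m * L..<m * L + L} = C" for m
    using sum.shift_bounds_nat_ivl[of f 0 "m * L" L]
    by (simp add: atLeast0LessThan add.commute[of L] per' C_def)
  have full: "(\<Sum>i<q * L. f i) = real q * C" for q
  proof -
    have "(\<Sum>i<q * L. f i) = (\<Sum>m<q. sum f {m * L..<m * L + L})"
      by (rule sum.nat_group[symmetric])
    also have "\<dots> = real q * C" by (simp add: block)
    finally show ?thesis .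
  qed
  have C: "0 \<le> C" unfolding C_def by (intro sum_nonneg nonneg)
  define q where "q = n div L"
  have q1: "q * L \<le> n" and q2: "n \<le> Suc q * L"
    using dividend_less_times_div[OF L, of n] by (auto simp: q_def algebra_simps)
  have "(\<Sum>i<n. f i) \<le> (\<Sum>i<Suc q * L. f i)"
    using q2 by (intro sum_mono2 nonneg) auto
  also have "\<dots> = real (Suc q) * C" by (rule full)
  also have "\<dots> \<le> (real n / real L + 1) * C"
  proof (rule mult_right_mono[OF _ C])
    have "real (q * L) \<le> real n" using q1 by (simp only: of_nat_le_iff)
    then show "real (Suc q) \<le> real n / real L + 1"
      using L by (simp add: field_simps)
  qed
  finally show "(\<Sum>i<n. f i) \<le> C * (real n / real L + 1)" by (simp add: mult.commute)
  have "(real n / real L - 1) * C \<le> real q * C"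
  proof (rule mult_right_mono[OF _ C])
    have "real n \<le> real (Suc q * L)" using q2 by (simp only: of_nat_le_iff)
    then show "real n / real L - 1 \<le> real q"
      using L by (simp add: field_simps)
  qed
  also have "\<dots> = (\<Sum>i<q * L. f i)" by (rule full[symmetric])
  also have "\<dots> \<le> (\<Sum>i<n. f i)"
    using q1 by (intro sum_mono2 nonneg) auto
  finally show "C * (real n / real L - 1) \<le> (\<Sum>i<n. f i)" by (simp add: mult.commute)
qed

lemma mem_free_set: "n \<in> free_set B \<longleftrightarrow> (\<forall>b\<in>B. \<not> int b dvd n)"
  by (auto simp: free_set_def dvd_def)

lemma free_set_antimono: "B \<subseteq> B' \<Longrightarrow> free_set B' \<subseteq> free_set B"
  by (meson mem_free_set subsetD subsetI)

definition period :: "nat set \<Rightarrow> nat" where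
  "period B = \<Prod>B"

definition free_residues :: "nat set \<Rightarrow> nat" where
  "free_residues B = card {i. i < period B \<and> int i \<in> free_set B}"

definition free_density :: "nat set \<Rightarrow> real" where
  "free_density B = real (free_residues B) / real (period B)"

lemma period_pos: "finite B \<Longrightarrow> 0 \<notin> B \<Longrightarrow> 0 < period B"
  unfolding period_def by (intro prod_pos) (auto intro: gr0I)

lemma dvd_period: "finite B \<Longrightarrow> b \<in> B \<Longrightarrow> b dvd period B"
  unfolding period_def by (rule dvd_prodI)

lemma free_density_bounds:
  assumes "finite B" "0 \<notin> B"
  shows "0 \<le> free_density B" "free_density B \<le> 1"
proof -
  have "free_residues B \<le> card {..<period B}"
    unfolding free_residues_def by (intro card_mono) auto
  then show "0 \<le> free_density B" "free_density B \<le> 1"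
    using period_pos[OF assms] by (simp_all add: free_density_def)
qed

text \<open>
  For finite \<open>B\<close> the free set is periodic, hence its counting function differs from a linear one
  by a bounded amount.
\<close>

lemma count_upto_free_set:
  assumes B: "finite B" "0 \<notin> B"
  obtains C where "0 \<le> C"
    "\<And>m. count_upto (free_set B) m \<le> free_density B * real m + C"
    "\<And>m. free_density B * real m - C \<le> count_upto (free_set B) m"
proof -
  define f :: "nat \<Rightarrow> real" where "f i = of_bool (int i \<in> free_set B)" for i
  define L where "L = period B"
  have L: "0 < L" unfolding L_def by (rule period_pos[OF B])
  have per: "f (i + L) = f i" for i
  proof -
    have "int b dvd int L" if "b \<in> B" for b
      using dvd_period[OF B(1) that] by (simp add: L_def)
    then show ?thesis
      by (simp add: f_def mem_free_set dvd_add_left_iff)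
  qed
  define C where "C = (\<Sum>i<L. f i)"
  have C: "C = real (free_residues B)"
    unfolding C_def f_def free_residues_def L_def
    by (simp add: of_bool_def sum.If_cases Int_def)
  have f: "0 \<le> f i" "f i \<le> 1" for i by (auto simp: f_def)
  note bounds = periodic_sum_bounds[of f L, OF per f(1) L, folded C_def]
  have cnt: "count_upto (free_set B) m = (\<Sum>i<Suc m. f i) - f 0" for m
    unfolding count_upto_def f_def[symmetric]
    by (simp add: lessThan_Suc_atMost sum.atLeast1_atMost_eq sum.atMost_shift)
  have d: "free_density B = C / real L" by (simp add: free_density_def C L_def)
  have d01: "0 \<le> C / real L" "C / real L \<le> 1"
    using free_density_bounds[OF B] by (simp_all add: d)
  have C0: "0 \<le> C" using C by simp
  show ?thesis
  proof (rule that[of "C + 1"])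
    fix m
    show "count_upto (free_set B) m \<le> free_density B * real m + (C + 1)"
      using bounds(1)[of "Suc m"] f(1)[of 0] d01
      by (simp add: cnt d algebra_simps add_divide_distrib)
    show "free_density B * real m - (C + 1) \<le> count_upto (free_set B) m"
      using bounds(2)[of "Suc m"] f(2)[of 0] d01
      by (simp add: cnt d algebra_simps add_divide_distrib)
  qed (use C0 in simp)
qed

section \<open>Weights on multiples\<close>

text \<open>
  Jordan's totient \<open>n powr c * (\<Prod>p | p dvd n. 1 - p powr (- c))\<close> with a real exponent \<open>c\<close>. Giving
  each exact prime power its own factor makes the function visibly multiplicative.
\<close>

definition jordan_totient :: "real \<Rightarrow> nat \<Rightarrow> real" where
  "jordan_totient c n = (\<Prod>p\<in>prime_factors n.
     real p powr (c * real (multiplicity p n)) - real p powr (c * (real (multiplicity p n) - 1)))"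

lemma jordan_totient_nonneg:
  assumes "0 \<le> c"
  shows "0 \<le> jordan_totient c n"
  unfolding jordan_totient_def
proof (rule prod_nonneg)
  fix p assume "p \<in> prime_factors n"
  then have "1 < real p"
    using prime_gt_1_nat[of p] by (auto simp: in_prime_factors_iff)
  then show "0 \<le> real p powr (c * real (multiplicity p n)) -
      real p powr (c * (real (multiplicity p n) - 1))"
    using assms by (simp add: powr_mono mult_left_mono)
qed

lemma jordan_totient_1: "jordan_totient c (Suc 0) = 1"
  by (simp add: jordan_totient_def)

lemma jordan_totient_prime_power_mult:
  assumes p: "prime p" and m: "\<not> p dvd m" and j: "0 < j"
  shows "jordan_totient c (p ^ j * m) =
    (real p powr (c * real j) - real p powr (c * (real j - 1))) * jordan_totient c m"
proof -
  have m0: "m \<noteq> 0" using m by (metis dvd_0_right)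
  have p0: "p \<noteq> 0" using p by auto
  have pf: "prime_factors (p ^ j * m) = insert p (prime_factors m)"
    using p j m0 p0 by (auto simp: prime_factors_product prime_factorization_prime_power)
  have self: "multiplicity p (p ^ j * m) = j"
    using p m m0 p0
    by (simp add: prime_elem_multiplicity_mult_distrib not_dvd_imp_multiplicity_0)
  have other: "multiplicity q (p ^ j * m) = multiplicity q m" if "q \<in> prime_factors m" for q
  proof -
    have q: "prime q" "q \<noteq> p" using that m by (auto simp: in_prime_factors_iff)
    then show ?thesis
      using p m0 p0 by (simp add: prime_elem_multiplicity_mult_distrib multiplicity_distinct_prime_power)
  qed
  have notin: "p \<notin> prime_factors m" using m by (auto simp: in_prime_factors_iff)
  show ?thesis
    unfolding jordan_totient_def pf
    by (simp add: notin self other)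
qed

text \<open>
  This generalizes \<open>\<Sum>d | d dvd n. totient d = n\<close>. Split off the full power \<open>p ^ k\<close> of one prime: a
  divisor of \<open>p ^ k * m\<close> is uniquely \<open>p ^ j * d\<close> with \<open>j \<le> k\<close> and \<open>d dvd m\<close>, and the sum over \<open>j\<close>
  telescopes to \<open>p powr (c k)\<close>.
\<close>

lemma sum_jordan_totient:
  assumes "0 < n"
  shows "(\<Sum>d | d dvd n. jordan_totient c d) = real n powr c"
  using assms
proof (induction n rule: less_induct)
  case (less n)
  show ?case
  proof (cases "n = 1")
    case True
    then show ?thesis by (simp add: jordan_totient_1)
  next
    case False
    then obtain p where p: "prime p" "p dvd n" using prime_factor_nat by blast
    define k where "k = multiplicity p n"
    have nu: "\<not> is_unit p" using p by auto
    obtain m where nm: "n = p ^ k * m" and m: "\<not> p dvd m"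
      using multiplicity_decompose'[of n p] less.prems nu unfolding k_def by auto
    have k: "0 < k"
      unfolding k_def using p less.prems nu by (simp add: multiplicity_gt_zero_iff)
    have m0: "0 < m" using m by (metis dvd_0_right gr0I)
    have p1: "1 < p" using p(1) by (rule prime_gt_1_nat)
    have "1 < p ^ k" using p1 k by (rule one_less_power)
    then have mn: "m < n" using m0 nm by simp
    have mult: "multiplicity p (p ^ j * d) = j" if "d dvd m" for j d
    proof -
      have d: "\<not> p dvd d" using m that by (meson dvd_trans)
      then have "d \<noteq> 0" by (metis dvd_0_right)
      then show ?thesis
        using p p1 d by (simp add: prime_elem_multiplicity_mult_distrib not_dvd_imp_multiplicity_0)
    qed
    have "(\<Sum>d | d dvd n. jordan_totient c d) =
        (\<Sum>(j, d)\<in>{..k} \<times> {d. d dvd m}. jordan_totient c (p ^ j * d))"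
    proof (rule sum.reindex_bij_witness[of _ "\<lambda>(j, d). p ^ j * d"
          "\<lambda>d. (multiplicity p d, d div p ^ multiplicity p d)"])
      fix d assume "d \<in> {d. d dvd n}"
      then have d: "d dvd n" and d0: "d \<noteq> 0" using less.prems by auto
      have eq: "d = p ^ multiplicity p d * (d div p ^ multiplicity p d)"
        using multiplicity_dvd[of p d] by simp
      show "(case (multiplicity p d, d div p ^ multiplicity p d) of (j, d) \<Rightarrow> p ^ j * d) = d"
        using eq by simp
      have le: "multiplicity p d \<le> k"
        unfolding k_def using d less.prems by (intro dvd_imp_multiplicity_le) auto
      have "\<not> p dvd d div p ^ multiplicity p d"
        using multiplicity_decompose[of d p] d0 nu by auto
      then have "coprime (d div p ^ multiplicity p d) (p ^ k)"
        using p by (metis coprime_commute coprime_power_right_iff prime_imp_coprime_nat)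
      moreover have "d div p ^ multiplicity p d dvd p ^ k * m"
        using d nm eq by (metis dvd_mult_right dvd_trans dvd_triv_right)
      ultimately have "d div p ^ multiplicity p d dvd m"
        by (simp add: coprime_dvd_mult_right_iff)
      then show "(multiplicity p d, d div p ^ multiplicity p d) \<in> {..k} \<times> {d. d dvd m}"
        using le by simp
      show "(case (multiplicity p d, d div p ^ multiplicity p d) of
          (j, d) \<Rightarrow> jordan_totient c (p ^ j * d)) = jordan_totient c d"
        using eq by simp
    next
      fix x assume "x \<in> {..k} \<times> {d. d dvd m}"
      then obtain j d where x: "x = (j, d)" "j \<le> k" "d dvd m" by auto
      show "(multiplicity p (case x of (j, d) \<Rightarrow> p ^ j * d),
          (case x of (j, d) \<Rightarrow> p ^ j * d) div
            p ^ multiplicity p (case x of (j, d) \<Rightarrow> p ^ j * d)) = x"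
        using x mult[of d j] p1 by simp
      show "(case x of (j, d) \<Rightarrow> p ^ j * d) \<in> {d. d dvd n}"
        using x nm by (auto intro: mult_dvd_mono le_imp_power_dvd)
    qed
    also have "\<dots> = (\<Sum>d | d dvd m. \<Sum>j\<le>k. jordan_totient c (p ^ j * d))"
      by (simp add: sum.cartesian_product[symmetric] sum.swap[of _ "{..k}"])
    also have "\<dots> = (\<Sum>d | d dvd m. real p powr (c * real k) * jordan_totient c d)"
    proof (rule sum.cong)
      fix d assume "d \<in> {d. d dvd m}"
      then have d: "\<not> p dvd d" using m by (auto dest: dvd_trans)
      show "(\<Sum>j\<le>k. jordan_totient c (p ^ j * d)) = real p powr (c * real k) * jordan_totient c d"
        for k
      proof (induction k)
        case 0
        show ?case using p1 by simp
      next
        case (Suc k)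
        show ?case
          using jordan_totient_prime_power_mult[OF p(1) d, of "Suc k" c] Suc
          by (simp add: algebra_simps)
      qed
    qed simp
    also have "\<dots> = real p powr (c * real k) * real m powr c"
      using less.IH[OF mn m0] by (simp add: sum_distrib_left[symmetric])
    also have "\<dots> = real n powr c"
      using p1 by (simp add: nm powr_mult powr_powr[symmetric] powr_realpow mult.commute[of c])
    finally show ?thesis .
  qed
qed

lemma inverse_eq_jordan_sum:
  assumes "0 < n"
  shows "real n powr (- 1) = (\<Sum>d | d dvd n. jordan_totient (s - 1) d * real n powr (- s))"
proof -
  have "real n powr (- 1) = real n powr (s - 1) * real n powr (- s)"
    by (simp add: powr_add[symmetric])
  then show ?thesis
    by (simp add: sum_jordan_totient[OF assms, symmetric] sum_distrib_right)
qed

text \<open>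
  The share that a set closed under multiples has of the total weight \<open>n powr (- s)\<close> can only grow
  when \<open>s\<close> decreases to 1, because smaller exponents favour integers with more divisors. The
  reason is that the weight \<open>1/n\<close> is a convolution with nonnegative coefficients,
  \<open>1/n = (\<Sum>d | d dvd n. J d * d powr (- s) * (n/d) powr (- s))\<close>, with \<open>J\<close> the totient of exponent
  \<open>s - 1\<close>: passing from \<open>s\<close> to 1 multiplies \<open>n/d\<close> by \<open>d\<close>, which does not leave the set. With
  \<open>H = (\<Sum>d\<le>Y. J d * d powr (- s))\<close> the claim follows by multiplying the estimates
  \<open>restricted_power_sum M s X * H \<le> restricted_power_sum M 1 (X * Y)\<close> and
  \<open>harm Y \<le> H * power_sum s Y\<close>. The sums are truncated at \<open>X\<close> and \<open>Y\<close>
  because at exponent 1 the full sums diverge.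
\<close>

lemma multiples_weight_comparison:
  assumes M: "\<And>n k. int n \<in> M \<Longrightarrow> int (n * k) \<in> M" and s: "1 < s"
  shows "restricted_power_sum M s X * harm Y \<le> restricted_power_sum M 1 (X * Y) * power_sum s Y"
proof -
  define J where "J = jordan_totient (s - 1)"
  have J: "0 \<le> J d" for d
    unfolding J_def using s by (intro jordan_totient_nonneg) simp
  have inv: "real n powr (- 1) = (\<Sum>d | d dvd n. J d * real n powr (- s))" if "0 < n" for n
    unfolding J_def by (rule inverse_eq_jordan_sum[OF that])
  define H where "H = (\<Sum>d=1..Y. J d * real d powr (- s))"
  have "restricted_power_sum M s X * H =
      (\<Sum>(m, d)\<in>{1..X} \<times> {1..Y}. of_bool (int m \<in> M) * J d * real (m * d) powr (- s))"
    unfolding restricted_power_sum_def H_def sum_product sum.cartesian_product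
    by (intro sum.cong) (auto simp: powr_mult)
  also have "\<dots> \<le> (\<Sum>(n, d)\<in>(SIGMA n:{1..X * Y}. {d. d dvd n}).
      of_bool (int n \<in> M) * J d * real n powr (- s))"
  proof (rule sum_le_included[where i = "\<lambda>(n, d). (n div d, d)"])
    show "\<forall>x\<in>{1..X} \<times> {1..Y}. \<exists>y\<in>SIGMA n:{1..X * Y}. {d. d dvd n}.
        (case y of (n, d) \<Rightarrow> (n div d, d)) = x \<and>
        (case x of (m, d) \<Rightarrow> of_bool (int m \<in> M) * J d * real (m * d) powr (- s)) \<le>
        (case y of (n, d) \<Rightarrow> of_bool (int n \<in> M) * J d * real n powr (- s))"
    proof
      fix x assume "x \<in> {1..X} \<times> {1..Y}"
      then obtain m d where x: "x = (m, d)" "1 \<le> m" "m \<le> X" "1 \<le> d" "d \<le> Y" by auto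
      have "m * d \<le> X * Y" using x by (intro mult_le_mono)
      moreover have "(of_bool (int m \<in> M) :: real) \<le> of_bool (int (m * d) \<in> M)"
        using M[of m d] by auto
      then have "of_bool (int m \<in> M) * J d * real (m * d) powr (- s) \<le>
          of_bool (int (m * d) \<in> M) * J d * real (m * d) powr (- s)"
        using J by (intro mult_right_mono) auto
      ultimately show "\<exists>y\<in>SIGMA n:{1..X * Y}. {d. d dvd n}.
        (case y of (n, d) \<Rightarrow> (n div d, d)) = x \<and>
        (case x of (m, d) \<Rightarrow> of_bool (int m \<in> M) * J d * real (m * d) powr (- s)) \<le>
        (case y of (n, d) \<Rightarrow> of_bool (int n \<in> M) * J d * real n powr (- s))"
        using x by (intro bexI[of _ "(m * d, d)"]) auto
    qed
  qed (use J in \<open>auto intro!: finite_SigmaI\<close>)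
  also have "\<dots> = restricted_power_sum M 1 (X * Y)"
    unfolding restricted_power_sum_def
    by (subst sum.Sigma[symmetric])
      (auto simp: inv[symmetric] sum_distrib_left[symmetric] mult.assoc intro!: sum.cong)
  finally have upper: "restricted_power_sum M s X * H \<le> restricted_power_sum M 1 (X * Y)" .
  have "harm Y = (\<Sum>(n, d)\<in>(SIGMA n:{1..Y}. {d. d dvd n}). J d * real n powr (- s))"
    unfolding power_sum_1[symmetric] power_sum_def
    by (subst sum.Sigma[symmetric]) (auto simp: inv[symmetric] intro!: sum.cong)
  also have "\<dots> \<le> (\<Sum>(d, m)\<in>{1..Y} \<times> {1..Y}. J d * real d powr (- s) * real m powr (- s))"
  proof (rule sum_le_included[where i = "\<lambda>(d, m). (d * m, d)"])
    show "\<forall>x\<in>SIGMA n:{1..Y}. {d. d dvd n}. \<exists>y\<in>{1..Y} \<times> {1..Y}.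
        (case y of (d, m) \<Rightarrow> (d * m, d)) = x \<and>
        (case x of (n, d) \<Rightarrow> J d * real n powr (- s)) \<le>
        (case y of (d, m) \<Rightarrow> J d * real d powr (- s) * real m powr (- s))"
    proof
      fix x assume "x \<in> (SIGMA n:{1..Y}. {d. d dvd n})"
      then obtain n d where x: "x = (n, d)" "1 \<le> n" "n \<le> Y" "d dvd n" by auto
      then obtain m where m: "n = d * m" by (auto elim: dvdE)
      have dm: "1 \<le> d" "1 \<le> m" using x m by (auto simp: Suc_le_eq intro: gr0I)
      have "d \<le> n" "m \<le> n" using dm by (auto simp: m)
      then have "d \<le> Y" "m \<le> Y" using x(3) by (auto intro: le_trans)
      then show "\<exists>y\<in>{1..Y} \<times> {1..Y}.
        (case y of (d, m) \<Rightarrow> (d * m, d)) = x \<and>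
        (case x of (n, d) \<Rightarrow> J d * real n powr (- s)) \<le>
        (case y of (d, m) \<Rightarrow> J d * real d powr (- s) * real m powr (- s))"
        using x dm by (intro bexI[of _ "(d, m)"]) (auto simp: m powr_mult)
    qed
  qed (use J in \<open>auto intro!: finite_SigmaI\<close>)
  also have "\<dots> = H * power_sum s Y"
    unfolding H_def power_sum_def sum_product sum.cartesian_product by simp
  finally have lower: "harm Y \<le> H * power_sum s Y" .
  have A: "0 \<le> restricted_power_sum M s X" "0 \<le> power_sum s Y"
    unfolding restricted_power_sum_def power_sum_def by (intro sum_nonneg; simp)+
  have "restricted_power_sum M s X * harm Y \<le> restricted_power_sum M s X * H * power_sum s Y"
    using mult_left_mono[OF lower A(1)] by (simp add: mult.assoc)
  also have "\<dots> \<le> restricted_power_sum M 1 (X * Y) * power_sum s Y"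
    by (rule mult_right_mono[OF upper A(2)])
  finally show ?thesis .
qed

text \<open>
  In the comparison lemma, the right-hand side is at most \<open>(1 - free_density B) * harm Y\<close> times the zeta
  value up to a bounded error, by periodicity; dividing by \<open>harm Y\<close> and letting \<open>Y\<close> grow removes
  the error.
\<close>

lemma multiples_power_sum_le:
  assumes B: "finite B" "0 \<notin> B" and s: "1 < s"
  shows "restricted_power_sum (- free_set B) s X \<le> (1 - free_density B) * zeta_value s"
proof (rule ccontr)
  assume neg: "\<not> ?thesis"
  define \<epsilon> where "\<epsilon> = restricted_power_sum (- free_set B) s X - (1 - free_density B) * zeta_value s"
  have \<epsilon>: "0 < \<epsilon>" using neg by (simp add: \<epsilon>_def)
  obtain C where C: "0 \<le> C" "\<And>m. free_density B * real m - C \<le> count_upto (free_set B) m"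
    using count_upto_free_set[OF B] by metis
  have d: "0 \<le> 1 - free_density B" "1 - free_density B \<le> 1"
    using free_density_bounds[OF B] by auto
  have up: "int (n * k) \<in> - free_set B" if "int n \<in> - free_set B" for n k
    using that unfolding mem_free_set of_nat_mult Compl_iff by (blast intro: dvd_mult2)
  have bound: "\<epsilon> * harm Y \<le> (real X + C) * zeta_value s" for Y
  proof -
    have "restricted_power_sum (- free_set B) s X * harm Y \<le>
        restricted_power_sum (- free_set B) 1 (X * Y) * power_sum s Y"
      by (rule multiples_weight_comparison[OF up s])
    also have "\<dots> \<le> ((1 - free_density B) * harm Y + real X + C) * power_sum s Y"
    proof (rule mult_right_mono)
      have "restricted_power_sum (- free_set B) 1 (X * Y) \<le>
          (1 - free_density B) * power_sum 1 (X * Y) + C"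
        by (rule restricted_power_sum_le)
          (use C(2) in \<open>auto simp: count_upto_Compl algebra_simps\<close>)
      also have "power_sum 1 (X * Y) \<le> harm Y + real X"
        unfolding power_sum_1 by (rule harm_mult_le)
      also have "(1 - free_density B) * (harm Y + real X) \<le> (1 - free_density B) * harm Y + real X"
        using mult_right_mono[OF d(2), of "real X"] by (simp add: distrib_left)
      finally show "restricted_power_sum (- free_set B) 1 (X * Y) \<le>
          (1 - free_density B) * harm Y + real X + C"
        using d by (simp add: mult_left_mono)
    qed (auto simp: power_sum_def intro!: sum_nonneg)
    also have "\<dots> \<le> ((1 - free_density B) * harm Y + real X + C) * zeta_value s"
      using d C(1) by (intro mult_left_mono power_sum_le_zeta s add_nonneg_nonneg mult_nonneg_nonneg harm_nonneg) auto
    finally show ?thesis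
      by (simp add: \<epsilon>_def algebra_simps)
  qed
  have "eventually (\<lambda>Y. harm Y > (real X + C) * zeta_value s / \<epsilon>) sequentially"
    using harm_at_top by (simp add: filterlim_at_top_dense)
  then obtain Y where "harm Y > (real X + C) * zeta_value s / \<epsilon>"
    by (auto simp: eventually_sequentially)
  with bound[of Y] \<epsilon> show False
    by (simp add: field_simps)
qed

section \<open>The logarithmic density of a free set\<close>

definition truncation :: "nat set \<Rightarrow> nat \<Rightarrow> nat set" where
  "truncation B K = {b\<in>B. b \<le> K}"

lemma truncation_simps:
  "finite (truncation B K)" "truncation B K \<subseteq> B" "0 \<notin> B \<Longrightarrow> 0 \<notin> truncation B K"
  by (auto simp: truncation_def)

text \<open>
  The free densities of the truncations decrease in \<open>K\<close>, so the infimum is their limit.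
\<close>

definition limit_density :: "nat set \<Rightarrow> real" where
  "limit_density B = (INF K. free_density (truncation B K))"

context
  fixes B :: "nat set"
  assumes B: "0 \<notin> B"
begin

lemma limit_density_le: "limit_density B \<le> free_density (truncation B K)"
  unfolding limit_density_def using free_density_bounds(1)[OF truncation_simps(1) truncation_simps(3)[OF B]]
  by (intro cINF_lower bdd_belowI2) auto

lemma limit_density_approx:
  assumes "limit_density B < a"
  obtains K where "free_density (truncation B K) < a"
  using assms free_density_bounds(1)[OF truncation_simps(1) truncation_simps(3)[OF B]]
  unfolding limit_density_def
  by (subst (asm) cINF_less_iff) (auto intro!: bdd_belowI2)

lemma restricted_power_sum_truncation:
  assumes "N \<le> K"
  shows "restricted_power_sum (- free_set B) s N = restricted_power_sum (- free_set (truncation B K)) s N"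
  unfolding restricted_power_sum_def
proof (intro sum.cong refl arg_cong2[where f = "(*)"] arg_cong[where f = of_bool])
  fix i assume i: "i \<in> {1..N}"
  then have "b \<le> K" if "b dvd i" for b
    using dvd_imp_le[OF that] assms by auto
  then show "(int i \<in> - free_set B) = (int i \<in> - free_set (truncation B K))"
    by (auto simp: mem_free_set truncation_def)
qed

text \<open>
  The integers that are multiples of some element of \<open>B\<close>, but of none up to \<open>K\<close>, are
  logarithmically rare for large \<open>K\<close>. At exponent \<open>s\<close>, the Dirichlet series of the multiples of
  \<open>B\<close> exceeds that of the multiples of the truncation by at most
  \<open>(free_density (truncation B K) - limit_density B) * zeta_value s\<close> up to
  a constant, and at \<open>s = 1 + 1 / ln N\<close> the weights \<open>n powr (- s)\<close> and \<open>1/n\<close> agree up to a factor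
  \<open>e\<close> for all \<open>n \<le> N\<close>. The factor is harmless because the density gap can be made
  arbitrarily small.
\<close>

lemma truncation_error:
  obtains C where "\<And>N. 2 \<le> N \<Longrightarrow>
    restricted_power_sum (free_set (truncation B K) - free_set B) 1 N \<le>
    exp 1 * (free_density (truncation B K) - limit_density B) * (1 + ln (real N)) + C"
proof -
  let ?F = "free_set (truncation B K)" and ?d = "free_density (truncation B K)"
  let ?T = "?F - free_set B"
  have BK: "finite (truncation B K)" "0 \<notin> truncation B K"
    using truncation_simps B by auto
  obtain C where C: "0 \<le> C" "\<And>m. count_upto ?F m \<le> ?d * real m + C"
    using count_upto_free_set[OF BK] by metis
  have sub: "- ?F \<subseteq> - free_set B"
    using free_set_antimono[OF truncation_simps(2)] by blast
  have T: "?T = - free_set B - (- ?F)" by auto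
  show ?thesis
  proof (rule that[of "exp 1 * C"])
    fix N :: nat assume N: "2 \<le> N"
    define s where "s = 1 + 1 / ln (real N)"
    have ln: "0 < ln (real N)" using N by simp
    have s: "1 < s" using ln by (simp add: s_def)
    \<comment> \<open>The upper bound for the multiples of \<open>B\<close> involves the full zeta value, the lower bound for the
      truncation only a partial sum; extending the range to \<open>X\<close> and letting \<open>X\<close> grow reconciles them.\<close>
    have *: "restricted_power_sum ?T s N \<le> (1 - limit_density B) * zeta_value s -
        ((1 - ?d) * power_sum s X - C)" if X: "N \<le> X" for X
    proof -
      have "restricted_power_sum ?T s N \<le> restricted_power_sum ?T s X"
        by (rule restricted_power_sum_mono[OF X])
      also have "\<dots> = restricted_power_sum (- free_set B) s X - restricted_power_sum (- ?F) s X"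
        unfolding T by (rule restricted_power_sum_Diff[OF sub])
      also have "restricted_power_sum (- free_set B) s X \<le> (1 - limit_density B) * zeta_value s"
      proof -
        have "restricted_power_sum (- free_set B) s X \<le>
            (1 - free_density (truncation B X)) * zeta_value s"
          unfolding restricted_power_sum_truncation[OF order_refl]
          using truncation_simps B s by (intro multiples_power_sum_le) auto
        also have "\<dots> \<le> (1 - limit_density B) * zeta_value s"
          using limit_density_le[of X] zeta_value_nonneg[OF s] by (intro mult_right_mono) auto
        finally show ?thesis .
      qed
      finally have "restricted_power_sum ?T s N \<le>
          (1 - limit_density B) * zeta_value s - restricted_power_sum (- ?F) s X"
        by simp
      moreover have "(1 - ?d) * power_sum s X - C \<le> restricted_power_sum (- ?F) s X"
        by (rule restricted_power_sum_ge)
          (use C(2) s in \<open>auto simp: count_upto_Compl algebra_simps\<close>)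
      ultimately show ?thesis by simp
    qed
    have "(\<lambda>X. (1 - limit_density B) * zeta_value s - ((1 - ?d) * power_sum s X - C))
        \<longlonglongrightarrow> (1 - limit_density B) * zeta_value s - ((1 - ?d) * zeta_value s - C)"
      by (intro tendsto_intros power_sum_tendsto_zeta s)
    then have "restricted_power_sum ?T s N \<le>
        (1 - limit_density B) * zeta_value s - ((1 - ?d) * zeta_value s - C)"
      using * by (intro tendsto_lowerbound[where F = sequentially])
        (auto simp: eventually_sequentially)
    also have "\<dots> = (?d - limit_density B) * zeta_value s + C"
      by (simp add: algebra_simps)
    also have "\<dots> \<le> (?d - limit_density B) * (1 + ln (real N)) + C"
      using zeta_value_le[OF s] limit_density_le[of K]
      by (intro add_mono mult_left_mono) (auto simp: s_def)
    finally have main: "restricted_power_sum ?T s N \<le>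
        (?d - limit_density B) * (1 + ln (real N)) + C" .
    have "restricted_power_sum ?T 1 N \<le> exp 1 * restricted_power_sum ?T s N"
      unfolding restricted_power_sum_def sum_distrib_left
    proof (rule sum_mono)
      fix i assume i: "i \<in> {1..N}"
      have "real i powr (1 / ln (real N)) = exp (ln (real i) / ln (real N))"
        using i by (simp add: powr_def)
      also have "\<dots> \<le> exp 1"
        using i N ln by (simp add: divide_le_eq)
      finally have "real i powr (- s) * real i powr (1 / ln (real N)) \<le> real i powr (- s) * exp 1"
        by (rule mult_left_mono) simp
      then have "real i powr (- 1) \<le> exp 1 * real i powr (- s)"
        by (simp add: s_def powr_add[symmetric] mult.commute[of "exp 1"])
      then show "of_bool (int i \<in> ?T) * real i powr (- 1) \<le>
          exp 1 * (of_bool (int i \<in> ?T) * real i powr (- s))"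
        by (cases "int i \<in> ?T") simp_all
    qed
    also have "\<dots> \<le> exp 1 * ((?d - limit_density B) * (1 + ln (real N)) + C)"
      using main by (intro mult_left_mono) auto
    finally show "restricted_power_sum ?T 1 N \<le>
        exp 1 * (?d - limit_density B) * (1 + ln (real N)) + exp 1 * C"
      by (simp add: algebra_simps)
  qed
qed

text \<open>
  The Davenport--Erdos theorem. The free set is contained in the free sets of the truncations,
  which are periodic; conversely the truncation error bounds what is lost.
\<close>

theorem davenport_erdos: "log_density_seq (free_set B) \<longlonglongrightarrow> limit_density B"
proof -
  let ?D = "limit_density B" and ?S = "restricted_power_sum (free_set B) 1"
  let ?d = "\<lambda>K. free_density (truncation B K)"
  have BK: "finite (truncation B K)" "0 \<notin> truncation B K" for K
    using truncation_simps B by auto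
  have upper: "\<exists>C. \<forall>N\<ge>2. log_density_seq (free_set B) N \<le> ?d K + C / ln (real N)" for K
  proof -
    obtain C where C: "0 \<le> C" "\<And>m. count_upto (free_set (truncation B K)) m \<le> ?d K * real m + C"
      using count_upto_free_set[OF BK] by metis
    have "count_upto (free_set B) m \<le> ?d K * real m + C" for m
      using C(2)[of m] by (rule order_trans[rotated])
        (intro count_upto_mono_set free_set_antimono truncation_simps)
    then have "log_density_seq (free_set B) N \<le> ?d K + (?d K + C) / ln (real N)"
      if "2 \<le> N" for N
      using that free_density_bounds(1)[OF BK] by (intro log_density_seq_le)
    then show ?thesis by blast
  qed
  have lower: "\<exists>C. \<forall>N\<ge>2. ?d K - exp 1 * (?d K - ?D) - C / ln (real N) \<le>
      log_density_seq (free_set B) N" for K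
  proof -
    obtain C where C: "0 \<le> C" "\<And>m. ?d K * real m - C \<le> count_upto (free_set (truncation B K)) m"
      using count_upto_free_set[OF BK] by metis
    obtain C' where C': "\<And>N. 2 \<le> N \<Longrightarrow>
        restricted_power_sum (free_set (truncation B K) - free_set B) 1 N \<le>
        exp 1 * (?d K - ?D) * (1 + ln (real N)) + C'"
      using truncation_error by metis
    have "?d K - exp 1 * (?d K - ?D) - (C + C' + exp 1 * (?d K - ?D)) / ln (real N) \<le>
        log_density_seq (free_set B) N" if N: "2 \<le> N" for N
    proof -
      have "?S N = restricted_power_sum (free_set (truncation B K)) 1 N -
          restricted_power_sum (free_set (truncation B K) - free_set B) 1 N"
        by (simp add: restricted_power_sum_Diff free_set_antimono truncation_simps)
      moreover have "?d K * harm N - C \<le> restricted_power_sum (free_set (truncation B K)) 1 N"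
        using restricted_power_sum_ge[OF C(2), of 1 N] by (simp add: power_sum_1)
      moreover have "?d K * ln (real N) \<le> ?d K * harm N"
      proof (rule mult_left_mono)
        have "ln (real N) \<le> ln (real N + 1)" using N by simp
        also have "\<dots> \<le> harm N" by (rule ln_le_harm)
        finally show "ln (real N) \<le> harm N" .
      qed (rule free_density_bounds(1)[OF BK])
      ultimately have "?d K * ln (real N) - C - (exp 1 * (?d K - ?D) * (1 + ln (real N)) + C') \<le> ?S N"
        using C'[OF N] by linarith
      then have "(?d K * ln (real N) - C - (exp 1 * (?d K - ?D) * (1 + ln (real N)) + C')) / ln (real N)
          \<le> ?S N / ln (real N)"
        using N by (intro divide_right_mono) auto
      also have "(?d K * ln (real N) - C - (exp 1 * (?d K - ?D) * (1 + ln (real N)) + C')) / ln (real N)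
          = ?d K - exp 1 * (?d K - ?D) - (C + C' + exp 1 * (?d K - ?D)) / ln (real N)"
        using N by (simp add: field_simps)
      finally show ?thesis by (simp add: log_density_seq_eq)
    qed
    then show ?thesis by blast
  qed
  show ?thesis
  proof (rule order_tendstoI)
    fix a assume a: "?D < a"
    then obtain K where K: "?d K < a" by (rule limit_density_approx)
    obtain C where C: "\<And>N. 2 \<le> N \<Longrightarrow> log_density_seq (free_set B) N \<le> ?d K + C / ln (real N)"
      using upper by blast
    have "(\<lambda>N. ?d K + C / ln (real N)) \<longlonglongrightarrow> ?d K + 0"
      by (intro tendsto_intros divide_ln_tendsto_0)
    then have "eventually (\<lambda>N. ?d K + C / ln (real N) < a) sequentially"
      using K by (intro order_tendstoD(2)) auto
    then show "eventually (\<lambda>N. log_density_seq (free_set B) N < a) sequentially"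
      using eventually_ge_at_top[of 2] by eventually_elim (use C in force)
  next
    fix a assume a: "a < ?D"
    then have "?D < ?D + (?D - a) / exp 1" by simp
    then obtain K where K: "?d K < ?D + (?D - a) / exp 1" by (rule limit_density_approx)
    have "exp 1 * (?d K - ?D) < ?D - a"
      using K by (simp add: field_simps)
    then have aK: "a < ?d K - exp 1 * (?d K - ?D) - 0"
      using limit_density_le[of K] by linarith
    obtain C where C: "\<And>N. 2 \<le> N \<Longrightarrow> ?d K - exp 1 * (?d K - ?D) - C / ln (real N) \<le>
        log_density_seq (free_set B) N"
      using lower by blast
    have "(\<lambda>N. ?d K - exp 1 * (?d K - ?D) - C / ln (real N)) \<longlonglongrightarrow>
        ?d K - exp 1 * (?d K - ?D) - 0"
      by (intro tendsto_intros divide_ln_tendsto_0)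
    then have "eventually (\<lambda>N. a < ?d K - exp 1 * (?d K - ?D) - C / ln (real N)) sequentially"
      using aK by (intro order_tendstoD(1)) auto
    then show "eventually (\<lambda>N. a < log_density_seq (free_set B) N) sequentially"
      using eventually_ge_at_top[of 2] by eventually_elim (use C in force)
  qed
qed

end

section \<open>Residue classes covering as little as possible\<close>

definition covered :: "nat set \<Rightarrow> (nat \<Rightarrow> int) \<Rightarrow> nat \<Rightarrow> int set" where
  "covered B r L = {n\<in>{0..<int L}. \<exists>b\<in>B. [n = r b] (mod int b)}"

lemma finite_covered: "finite (covered B r L)"
  by (rule finite_subset[of _ "{0..<int L}"]) (auto simp: covered_def)

text \<open>
  By the Chinese remainder theorem some \<open>t\<close> is \<open>0\<close> modulo \<open>M\<close> and \<open>a\<close> modulo \<open>q\<close>; translation by \<open>t\<close>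
  on the integers modulo \<open>L\<close> maps one set into the other.
\<close>

lemma card_residue_class_translate:
  fixes q M L y a :: int
  assumes cop: "coprime q M" and modulus_dvd: "q * M dvd L"
  shows "card {n\<in>{0..<L}. [n = y] (mod M) \<and> [n = 0] (mod q)} \<le>
    card {n\<in>{0..<L}. [n = y] (mod M) \<and> [n = a] (mod q)}"
proof -
  obtain t where t: "[t = 0] (mod M)" "[t = a] (mod q)"
    using binary_chinese_remainder_int[of M q 0 a] cop by (auto simp: coprime_commute)
  have divs: "M dvd L" "q dvd L" using modulus_dvd by (auto dest: dvd_mult_left dvd_mult_right)
  show ?thesis
  proof (rule card_inj_on_le[where f = "\<lambda>n. (n + t) mod L"])
    show "inj_on (\<lambda>n. (n + t) mod L) {n\<in>{0..<L}. [n = y] (mod M) \<and> [n = 0] (mod q)}"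
    proof (rule inj_onI)
      fix n n' assume n: "n \<in> {n\<in>{0..<L}. [n = y] (mod M) \<and> [n = 0] (mod q)}"
        "n' \<in> {n\<in>{0..<L}. [n = y] (mod M) \<and> [n = 0] (mod q)}"
        and "(n + t) mod L = (n' + t) mod L"
      then have "[n + t = n' + t] (mod L)" by (simp add: cong_def)
      then have "[n = n'] (mod L)" by (simp only: cong_add_rcancel)
      moreover have "n mod L = n" "n' mod L = n'" using n by auto
      ultimately show "n = n'" by (simp add: cong_def)
    qed
    show "(\<lambda>n. (n + t) mod L) ` {n\<in>{0..<L}. [n = y] (mod M) \<and> [n = 0] (mod q)} \<subseteq>
        {n\<in>{0..<L}. [n = y] (mod M) \<and> [n = a] (mod q)}"
    proof clarify
      fix n assume n: "n \<in> {0..<L}" "[n = y] (mod M)" "[n = 0] (mod q)"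
      have L: "0 < L" using n by auto
      have "[(n + t) mod L = n + t] (mod L)" by (simp add: cong_def)
      then have c: "[(n + t) mod L = n + t] (mod M)" "[(n + t) mod L = n + t] (mod q)"
        using divs cong_dvd_modulus by blast+
      have "[n + t = y + 0] (mod M)" "[n + t = 0 + a] (mod q)"
        using cong_add[OF n(2) t(1)] cong_add[OF n(3) t(2)] by simp_all
      then show "(n + t) mod L \<in> {0..<L} \<and> [(n + t) mod L = y] (mod M) \<and> [(n + t) mod L = a] (mod q)"
        using c L by (auto intro: cong_trans)
    qed
  qed (rule finite_subset[of _ "{0..<L}"], auto)
qed

text \<open>
  Replacing the \<open>p\<close>-part of every residue by 0 shrinks the covered set, even within each residue
  class \<open>y\<close> modulo the \<open>p\<close>-free part \<open>M\<close> of \<open>L\<close>. Such a class is a copy of the integers modulo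
  \<open>p ^ multiplicity p L\<close>, and the moduli that are active in it cover residue classes modulo
  powers of \<open>p\<close> there. If all these classes pass through 0, they are nested and their union is the
  largest of them; for other residues the union still contains a class of that size.
\<close>

lemma card_covered_clear_prime:
  assumes B: "finite B" and L: "0 < L" "\<And>b. b \<in> B \<Longrightarrow> b dvd L" and p: "prime p"
    and zero: "\<And>b. b \<in> B \<Longrightarrow> [r' b = 0] (mod int (p ^ multiplicity p b))"
    and same: "\<And>b. b \<in> B \<Longrightarrow> [r' b = r b] (mod int (b div p ^ multiplicity p b))"
  shows "card (covered B r' L) \<le> card (covered B r L)"
proof -
  define v where "v b = multiplicity p b" for b
  define rest where "rest b = b div p ^ v b" for b
  define M where "M = rest L"
  have nu: "\<not> is_unit p" using p by auto
  have b0: "b \<noteq> 0" if "b \<in> B" for b using L(1) L(2)[OF that] by auto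
  have split: "b = p ^ v b * rest b" for b
    unfolding rest_def v_def using multiplicity_dvd[of p b] by simp
  have cop: "coprime (p ^ i) (rest b)" if "b \<noteq> 0" for b i
  proof -
    have "\<not> p dvd rest b"
      unfolding rest_def v_def using multiplicity_decompose[OF that nu] .
    then show ?thesis using p by (metis coprime_power_left_iff prime_imp_coprime_nat)
  qed
  have rest_dvd: "rest b dvd M" if "b \<in> B" for b
  proof -
    have "rest b dvd p ^ v L * M"
      unfolding M_def split[of L, symmetric] using L(2)[OF that] split[of b]
      by (metis dvd_mult_right)
    then show ?thesis
      using cop[OF b0[OF that], of "v L"] by (simp add: coprime_dvd_mult_right_iff coprime_commute)
  qed
  have M: "0 < M" using split[of L] L(1) unfolding M_def by (metis gr0I mult_0_right)
  have decompose: "card (covered B s L) =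
      (\<Sum>y\<in>{0..<int M}. card {n \<in> covered B s L. n mod int M = y})" for s
  proof -
    have "(\<Sum>y\<in>{0..<int M}. \<Sum>n\<in>{n \<in> covered B s L. n mod int M = y}. 1) =
        (\<Sum>n\<in>covered B s L. 1::nat)"
      using M by (intro sum.group) (auto simp: finite_covered)
    then show ?thesis by simp
  qed
  show ?thesis unfolding decompose
  proof (rule sum_mono)
    fix y assume "y \<in> {0..<int M}"
    then have y: "0 \<le> y" "y < int M" by auto
    \<comment> \<open>The moduli active in the class of \<open>y\<close>; they do not depend on the \<open>p\<close>-parts of the residues.\<close>
    define S where "S = {b\<in>B. [y = r b] (mod int (rest b))}"
    have to_S: "b \<in> S" if "b \<in> B" "n mod int M = y" "[n = r' b] (mod int (rest b))" for n b
    proof -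
      have "[n = y] (mod int M)" using that(2) by (auto simp: cong_def)
      then have "[n = y] (mod int (rest b))"
        using rest_dvd[OF that(1)] by (auto intro: cong_dvd_modulus)
      moreover have "[r' b = r b] (mod int (rest b))"
        using same[OF that(1)] by (simp add: rest_def v_def)
      ultimately show ?thesis
        using that by (auto simp: S_def intro: cong_trans cong_sym)
    qed
    have modulus: "[n = r b] (mod int b) \<longleftrightarrow>
        [n = r b] (mod int (p ^ v b)) \<and> [n = r b] (mod int (rest b))" if "b \<in> B" for n b r
    proof -
      have "coprime (int (p ^ v b)) (int (rest b))"
        using cop[OF b0[OF that]] by (simp only: coprime_int_iff)
      then have "[n = r b] (mod int (p ^ v b) * int (rest b)) \<longleftrightarrow>
        [n = r b] (mod int (p ^ v b)) \<and> [n = r b] (mod int (rest b))"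
        by (metis coprime_cong_mult cong_modulus_mult mult.commute)
      then show ?thesis using split[of b] by (metis of_nat_mult)
    qed
    show "card {n \<in> covered B r' L. n mod int M = y} \<le> card {n \<in> covered B r L. n mod int M = y}"
    proof (cases "S = {}")
      case True
      have "{n \<in> covered B r' L. n mod int M = y} = {}"
        using True to_S modulus by (fastforce simp: covered_def)
      then show ?thesis by (metis card.empty le0)
    next
      case False
      have finS: "finite S" using B by (simp add: S_def)
      \<comment> \<open>The smallest power of \<open>p\<close> gives the largest class.\<close>
      define c where "c = arg_min_on v S"
      have c: "c \<in> S" "\<And>b. b \<in> S \<Longrightarrow> v c \<le> v b"
        unfolding c_def using arg_min_if_finite[OF finS False, of v]
        by (auto simp: not_less)
      have cB: "c \<in> B" "[y = r c] (mod int (rest c))" using c(1) by (auto simp: S_def)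
      let ?q = "int (p ^ v c)"
      have "{n \<in> covered B r' L. n mod int M = y} \<subseteq>
          {n\<in>{0..<int L}. [n = y] (mod int M) \<and> [n = 0] (mod ?q)}"
      proof clarify
        fix n assume n: "n \<in> covered B r' L" "y = n mod int M"
        then obtain b where b: "b \<in> B" "[n = r' b] (mod int b)" by (auto simp: covered_def)
        then have bS: "b \<in> S" using to_S[of b n] modulus n by auto
        have "[n = r' b] (mod int (p ^ v b))" using b modulus by auto
        then have "[n = 0] (mod int (p ^ v b))"
          using zero[OF b(1)] by (auto simp: v_def intro: cong_trans)
        moreover have "?q dvd int (p ^ v b)"
          using c(2)[OF bS] by (simp add: le_imp_power_dvd)
        ultimately have "[n = 0] (mod ?q)" by (rule cong_dvd_modulus)
        then show "n \<in> {0..<int L} \<and> [n = n mod int M] (mod int M) \<and> [n = 0] (mod ?q)"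
          using n by (auto simp: covered_def cong_def)
      qed
      then have "card {n \<in> covered B r' L. n mod int M = y} \<le>
          card {n\<in>{0..<int L}. [n = y] (mod int M) \<and> [n = 0] (mod ?q)}"
        by (rule card_mono[rotated]) (rule finite_subset[of _ "{0..<int L}"], auto)
      also have "\<dots> \<le> card {n\<in>{0..<int L}. [n = y] (mod int M) \<and> [n = r c] (mod ?q)}"
      proof (rule card_residue_class_translate)
        show "coprime ?q (int M)"
          using cop[of L "v c"] L(1) unfolding M_def by (simp only: coprime_int_iff)
        have "v c \<le> v L"
          unfolding v_def using L cB by (intro dvd_imp_multiplicity_le) auto
        then have "p ^ v c * M dvd p ^ v L * M" by (simp add: le_imp_power_dvd)
        then have "p ^ v c * M dvd L" using split[of L] by (simp add: M_def)
        then show "?q * int M dvd int L" by (metis of_nat_dvd_iff of_nat_mult)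
      qed
      also have "\<dots> \<le> card {n \<in> covered B r L. n mod int M = y}"
      proof (rule card_mono)
        show "{n\<in>{0..<int L}. [n = y] (mod int M) \<and> [n = r c] (mod ?q)} \<subseteq>
            {n \<in> covered B r L. n mod int M = y}"
        proof clarify
          fix n assume n: "n \<in> {0..<int L}" "[n = y] (mod int M)" "[n = r c] (mod ?q)"
          have "[n = y] (mod int (rest c))"
            using n(2) rest_dvd[OF cB(1)] by (auto intro: cong_dvd_modulus)
          then have "[n = r c] (mod int (rest c))" using cB(2) by (rule cong_trans)
          then have "[n = r c] (mod int c)" using n(3) modulus[OF cB(1)] by auto
          then show "n \<in> covered B r L \<and> n mod int M = y"
            using n cB(1) y by (auto simp: covered_def cong_def)
        qed
      qed (simp add: finite_covered)
      finally show ?thesis .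
    qed
  qed
qed

lemma card_covered_clear_primes:
  assumes B: "finite B" and L: "0 < L" "\<And>b. b \<in> B \<Longrightarrow> b dvd L"
    and P: "finite P" "\<And>p. p \<in> P \<Longrightarrow> prime p"
  shows "\<exists>r'. card (covered B r' L) \<le> card (covered B r L) \<and>
    (\<forall>p\<in>P. \<forall>b\<in>B. [r' b = 0] (mod int (p ^ multiplicity p b)))"
  using P
proof (induction P rule: finite_induct)
  case empty
  then show ?case by auto
next
  case (insert p P)
  then obtain r1 where r1: "card (covered B r1 L) \<le> card (covered B r L)"
    "\<And>q b. q \<in> P \<Longrightarrow> b \<in> B \<Longrightarrow> [r1 b = 0] (mod int (q ^ multiplicity q b))"
    by auto
  have p: "prime p" using insert by auto
  have b0: "b \<noteq> 0" if "b \<in> B" for b using L(1) L(2)[OF that] by auto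
  have split: "b = p ^ multiplicity p b * (b div p ^ multiplicity p b)" for b
    using multiplicity_dvd[of p b] by simp
  have "\<exists>x. b \<in> B \<longrightarrow> [x = 0] (mod int (p ^ multiplicity p b)) \<and>
      [x = r1 b] (mod int (b div p ^ multiplicity p b))" for b
  proof (cases "b \<in> B")
    case True
    have "\<not> p dvd b div p ^ multiplicity p b"
      using multiplicity_decompose[OF b0[OF True]] p by (metis not_prime_unit)
    then have "coprime (p ^ multiplicity p b) (b div p ^ multiplicity p b)"
      using p by (metis coprime_power_left_iff prime_imp_coprime_nat)
    then have "coprime (int (p ^ multiplicity p b)) (int (b div p ^ multiplicity p b))"
      by (simp only: coprime_int_iff)
    then show ?thesis using binary_chinese_remainder_int by blast
  qed simp
  then obtain r' where r': "\<And>b. b \<in> B \<Longrightarrow> [r' b = 0] (mod int (p ^ multiplicity p b))"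
      "\<And>b. b \<in> B \<Longrightarrow> [r' b = r1 b] (mod int (b div p ^ multiplicity p b))"
    by metis
  have "card (covered B r' L) \<le> card (covered B r1 L)"
    by (rule card_covered_clear_prime[OF B L p r'])
  moreover have "[r' b = 0] (mod int (q ^ multiplicity q b))" if "q \<in> P" "b \<in> B" for q b
  proof -
    have q: "prime q" "q \<noteq> p" using insert that by auto
    have "q ^ multiplicity q b dvd p ^ multiplicity p b * (b div p ^ multiplicity p b)"
      using split[of b] multiplicity_dvd[of q b] by simp
    moreover have "coprime (q ^ multiplicity q b) (p ^ multiplicity p b)"
      using p q by (simp add: primes_coprime)
    ultimately have "q ^ multiplicity q b dvd b div p ^ multiplicity p b"
      by (simp add: coprime_dvd_mult_right_iff)
    then have "[r' b = r1 b] (mod int (q ^ multiplicity q b))"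
      using r'(2)[OF that(2)] by (metis cong_dvd_modulus of_nat_dvd_iff)
    then show ?thesis using r1(2)[OF that] by (rule cong_trans)
  qed
  ultimately show ?case using r1(1) r'(1) by (intro exI[of _ r']) auto
qed

text \<open>
  Rogers' theorem: among all choices of one residue class for each modulus, the classes of 0 cover
  the fewest integers. Clearing one prime after another turns every residue into one that is
  divisible by its modulus.
\<close>

theorem rogers:
  assumes B: "finite B" and L: "0 < L" "\<And>b. b \<in> B \<Longrightarrow> b dvd L"
  shows "card (covered B (\<lambda>_. 0) L) \<le> card (covered B r L)"
proof -
  have b0: "b \<noteq> 0" if "b \<in> B" for b using L(1) L(2)[OF that] by auto
  define P where "P = (\<Union>b\<in>B. prime_factors b)"
  have "finite P" "\<And>p. p \<in> P \<Longrightarrow> prime p"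
    using B by (auto simp: P_def in_prime_factors_iff)
  from card_covered_clear_primes[OF B L this] obtain r' where
    r': "card (covered B r' L) \<le> card (covered B r L)"
    "\<And>p b. p \<in> P \<Longrightarrow> b \<in> B \<Longrightarrow> [r' b = 0] (mod int (p ^ multiplicity p b))"
    by blast
  have "[r' b = 0] (mod int b)" if b: "b \<in> B" for b
  proof -
    have "[r' b = 0] (mod (\<Prod>p\<in>prime_factors b. int (p ^ multiplicity p b)))"
    proof (intro cong_cong_prod_coprime ballI impI)
      fix p q assume "p \<in> prime_factors b" "q \<in> prime_factors b" "p \<noteq> q"
      then have "coprime (p ^ multiplicity p b) (q ^ multiplicity q b)"
        by (simp add: primes_coprime in_prime_factors_iff)
      then show "coprime (int (p ^ multiplicity p b)) (int (q ^ multiplicity q b))"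
        by (simp only: coprime_int_iff)
    next
      fix p assume "p \<in> prime_factors b"
      then show "[r' b = 0] (mod int (p ^ multiplicity p b))"
        using b by (intro r'(2)) (auto simp: P_def)
    qed
    also have "(\<Prod>p\<in>prime_factors b. int (p ^ multiplicity p b)) = int b"
      using prod_prime_factors[OF b0[OF b]] by (metis normalize_nat_def of_nat_prod id_apply)
    finally show ?thesis .
  qed
  then have "[n = 0] (mod int b) \<longleftrightarrow> [n = r' b] (mod int b)" if "b \<in> B" for n b
    using that by (meson cong_sym cong_trans)
  then have "covered B (\<lambda>_. 0) L = covered B r' L"
    unfolding covered_def by (intro Collect_cong) auto
  then show ?thesis using r'(1) by simp
qed

section \<open>Blocks and entropy\<close>

lemma length_blocks: "xs \<in> blocks n X \<Longrightarrow> length xs = n"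
  by (auto simp: blocks_def)

lemma finite_blocks: "finite (blocks n X)"
  by (rule finite_subset[OF _ finite_lists_length_eq[of "UNIV :: bool set" n]])
    (auto simp: length_blocks)

lemma blocks_mono: "X \<subseteq> Y \<Longrightarrow> blocks n X \<subseteq> blocks n Y"
  unfolding blocks_def by blast

lemma card_blocks_add: "card (blocks (m + n) X) \<le> card (blocks m X) * card (blocks n X)"
proof -
  have "card (blocks (m + n) X) \<le> card (blocks m X \<times> blocks n X)"
  proof (rule card_inj_on_le[where f = "\<lambda>xs. (take m xs, drop m xs)"])
    show "inj_on (\<lambda>xs. (take m xs, drop m xs)) (blocks (m + n) X)"
      by (rule inj_onI) (metis append_take_drop_id prod.inject)
    show "(\<lambda>xs. (take m xs, drop m xs)) ` blocks (m + n) X \<subseteq> blocks m X \<times> blocks n X"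
    proof (rule image_subsetI)
      fix xs assume "xs \<in> blocks (m + n) X"
      then obtain x k where x: "x \<in> X" and xs: "xs = map (\<lambda>i. x (k + int i)) [0..<m + n]"
        by (auto simp: blocks_def)
      have "take m xs = map (\<lambda>i. x (k + int i)) [0..<m]"
        by (simp add: xs take_map)
      moreover have "drop m xs = map (\<lambda>i. x (k + int m + int i)) [0..<n]"
        by (rule nth_equalityI) (auto simp: xs add.assoc)
      ultimately show "(take m xs, drop m xs) \<in> blocks m X \<times> blocks n X"
        using x unfolding blocks_def by auto
    qed
  qed (simp add: finite_blocks)
  then show ?thesis by (simp add: card_cartesian_product)
qed

lemma card_blocks_mult: "card (blocks (q * n) X) \<le> card (blocks n X) ^ q"
proof (induction q)
  case 0
  have "blocks 0 X \<subseteq> {[]}" by (auto simp: blocks_def)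
  then show ?case using card_mono[of "{[]}" "blocks 0 X"] by simp
next
  case (Suc q)
  have "card (blocks (Suc q * n) X) \<le> card (blocks n X) * card (blocks (q * n) X)"
    using card_blocks_add[of n "q * n"] by simp
  also have "\<dots> \<le> card (blocks n X) * card (blocks n X) ^ q"
    by (rule mult_le_mono2[OF Suc])
  finally show ?case by simp
qed

lemma card_blocks_mono_length:
  assumes "m \<le> n"
  shows "card (blocks m X) \<le> card (blocks n X)"
proof (rule surj_card_le)
  show "blocks m X \<subseteq> take m ` blocks n X"
  proof
    fix xs assume "xs \<in> blocks m X"
    then obtain x k where x: "x \<in> X" "xs = map (\<lambda>i. x (k + int i)) [0..<m]"
      by (auto simp: blocks_def)
    then have "xs = take m (map (\<lambda>i. x (k + int i)) [0..<n])"
      using assms by (simp add: take_map)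
    then show "xs \<in> take m ` blocks n X"
      using x(1) unfolding blocks_def by blast
  qed
qed (rule finite_blocks)

text \<open>
  Every subset of the free integers in \<open>[1, N]\<close> is the support of a point below \<open>eta B\<close>, and
  different subsets give different blocks.
\<close>

lemma card_blocks_hereditary:
  assumes her: "hereditary X" and eta: "eta B \<in> X"
  shows "2 powr count_upto (free_set B) N \<le> real (card (blocks N X))"
proof -
  define G where "G = {i. i < N \<and> 1 + int i \<in> free_set B}"
  have finG: "finite G" by (simp add: G_def)
  have cnt: "count_upto (free_set B) N = real (card G)"
  proof -
    have "count_upto (free_set B) N = (\<Sum>i<N. of_bool (1 + int i \<in> free_set B))"
      unfolding count_upto_def
      by (rule sum.reindex_bij_witness[of _ Suc "\<lambda>i. i - 1"]) (auto simp: add.commute)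
    also have "\<dots> = real (card G)"
      by (simp add: G_def of_bool_def sum.If_cases Int_def)
    finally show ?thesis .
  qed
  have "card (Pow G) \<le> card (blocks N X)"
  proof (rule card_inj_on_le[where f = "\<lambda>S. map (\<lambda>i. i \<in> S) [0..<N]"])
    show "inj_on (\<lambda>S. map (\<lambda>i. i \<in> S) [0..<N]) (Pow G)"
    proof (rule inj_onI)
      fix S T assume "S \<in> Pow G" "T \<in> Pow G" and eq: "map (\<lambda>i. i \<in> S) [0..<N] = map (\<lambda>i. i \<in> T) [0..<N]"
      then have "S \<subseteq> {..<N}" "T \<subseteq> {..<N}" by (auto simp: G_def)
      moreover have "i \<in> S \<longleftrightarrow> i \<in> T" if "i < N" for i
        using arg_cong[OF eq, of "\<lambda>xs. xs ! i"] that by simp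
      ultimately show "S = T" by blast
    qed
    show "(\<lambda>S. map (\<lambda>i. i \<in> S) [0..<N]) ` Pow G \<subseteq> blocks N X"
    proof (rule image_subsetI)
      fix S assume S: "S \<in> Pow G"
      \<comment> \<open>Index \<open>i\<close> of the block sits at the integer \<open>1 + i\<close>.\<close>
      define y :: bseq where "y n = (1 \<le> n \<and> nat (n - 1) \<in> S)" for n
      have "y \<le> eta B"
      proof (rule le_funI, rule le_boolI)
        fix n assume "y n"
        then have "1 \<le> n" "nat (n - 1) \<in> G" using S by (auto simp: y_def)
        then show "eta B n" by (simp add: G_def eta_def)
      qed
      then have "y \<in> X" using her eta by (auto simp: hereditary_def)
      moreover have "map (\<lambda>i. i \<in> S) [0..<N] = map (\<lambda>i. y (1 + int i)) [0..<N]"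
        by (simp add: y_def)
      ultimately show "map (\<lambda>i. i \<in> S) [0..<N] \<in> blocks N X"
        unfolding blocks_def by blast
    qed
  qed (rule finite_blocks)
  then have "real (2 ^ card G) \<le> real (card (blocks N X))"
    by (simp only: card_Pow[OF finG] of_nat_le_iff)
  then show ?thesis by (simp add: cnt powr_realpow)
qed

text \<open>
  Submultiplicativity of block numbers gives \<open>count_upto (free_set B) N \<le> a * (N + n)\<close> for all \<open>N\<close>,
  where \<open>a\<close> is the entropy term of length \<open>n\<close>. Summation by parts makes \<open>a\<close> an upper bound for the
  logarithmic density. The bound holds for every single \<open>n\<close>, not just in the limit, which is what
  makes the entropy sequence converge.
\<close>

lemma limit_density_le_entropy_seq:
  assumes B: "0 \<notin> B" and her: "hereditary X" and eta: "eta B \<in> X" and n: "0 < n"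
  shows "limit_density B \<le> entropy_seq X n"
proof -
  define a where "a = entropy_seq X n"
  have pos: "1 \<le> real (card (blocks m X))" for m
  proof -
    have "0 < real (card (blocks m X))"
      using card_blocks_hereditary[OF her eta, of m] by (rule less_le_trans[rotated]) simp
    then show ?thesis by simp
  qed
  have log: "log 2 (real (card (blocks n X))) = a * real n"
    using n by (simp add: a_def entropy_seq_def)
  have a: "0 \<le> a" using pos[of n] by (simp add: a_def entropy_seq_def)
  have bound: "count_upto (free_set B) N \<le> a * real N + a * real n" for N
  proof -
    \<comment> \<open>The number of blocks of length \<open>n\<close> needed to cover \<open>N\<close> positions.\<close>
    define q where "q = Suc (N div n)"
    have N: "N \<le> q * n" using dividend_less_times_div[OF n, of N] by (simp add: q_def algebra_simps)
    have q: "real q * real n \<le> real N + real n"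
    proof -
      have "q * n \<le> N + n" by (simp add: q_def)
      then show ?thesis by (simp only: of_nat_mult[symmetric] of_nat_add[symmetric] of_nat_le_iff)
    qed
    have "2 powr count_upto (free_set B) N \<le> real (card (blocks N X))"
      by (rule card_blocks_hereditary[OF her eta])
    also have "card (blocks N X) \<le> card (blocks n X) ^ q"
      using card_blocks_mono_length[OF N] card_blocks_mult by (rule order_trans)
    finally have "2 powr count_upto (free_set B) N \<le> real (card (blocks n X)) ^ q"
      by simp
    then have "log 2 (2 powr count_upto (free_set B) N) \<le> log 2 (real (card (blocks n X)) ^ q)"
      using pos[of n] by (subst log_le_cancel_iff) auto
    then have "count_upto (free_set B) N \<le> real q * (a * real n)"
      using pos[of n] by (simp add: log_nat_power log)
    also have "\<dots> \<le> a * (real N + real n)"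
      using mult_left_mono[OF q a] by (simp add: algebra_simps)
    finally show ?thesis by (simp add: algebra_simps)
  qed
  have "(\<lambda>N. a + (a + a * real n) / ln (real N)) \<longlonglongrightarrow> a + 0"
    by (intro tendsto_intros divide_ln_tendsto_0)
  moreover have "\<forall>N\<ge>2. log_density_seq (free_set B) N \<le> a + (a + a * real n) / ln (real N)"
    using log_density_seq_le[OF bound a] by blast
  ultimately show ?thesis
    unfolding a_def[symmetric] using LIMSEQ_le[OF davenport_erdos[OF B]] by fastforce
qed

text \<open>
  Per period, the integers avoiding all classes are most numerous when the classes are those of 0,
  by Rogers' theorem.
\<close>

lemma card_avoiding_residues:
  assumes B: "finite B" "0 \<notin> B"
  shows "real (card {i. i < n \<and> (\<forall>b\<in>B. \<not> [int i = r b] (mod int b))}) \<le>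
    real (free_residues B) * (real n / real (period B) + 1)"
proof -
  define L where "L = period B"
  define P where "P r i \<longleftrightarrow> (\<forall>b\<in>B. \<not> [int i = r b] (mod int b))" for r i
  define f :: "nat \<Rightarrow> real" where "f i = of_bool (P r i)" for i
  have L: "0 < L" "\<And>b. b \<in> B \<Longrightarrow> b dvd L"
    using period_pos[OF B] dvd_period[OF B(1)] by (auto simp: L_def)
  have card_P: "card {i. i < L \<and> P s i} = L - card (covered B s L)" for s
  proof -
    have "card {i. i < L \<and> P s i} = card (int ` {i. i < L \<and> P s i})"
      by (simp add: card_image)
    also have "int ` {i. i < L \<and> P s i} = {0..<int L} - covered B s L"
    proof (intro equalityI subsetI)
      fix x assume "x \<in> {0..<int L} - covered B s L"
      then show "x \<in> int ` {i. i < L \<and> P s i}"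
        by (intro image_eqI[of _ _ "nat x"]) (auto simp: covered_def P_def)
    qed (auto simp: covered_def P_def)
    also have "card \<dots> = L - card (covered B s L)"
      using finite_covered by (subst card_Diff_subset) (auto simp: covered_def)
    finally show ?thesis .
  qed
  have "card {i. i < L \<and> P r i} \<le> card {i. i < L \<and> P (\<lambda>_. 0) i}"
    unfolding card_P using rogers[OF B(1) L, of r] by simp
  also have "{i. i < L \<and> P (\<lambda>_. 0) i} = {i. i < period B \<and> int i \<in> free_set B}"
    by (auto simp: L_def P_def mem_free_set cong_0_iff)
  finally have rogers: "card {i. i < L \<and> P r i} \<le> free_residues B"
    by (simp add: free_residues_def)
  have card_f: "(\<Sum>i<m. f i) = real (card {i. i < m \<and> P r i})" for m
    by (simp add: f_def of_bool_def sum.If_cases Int_def)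
  have "f (i + L) = f i" for i
  proof -
    have "[int (i + L) = r b] (mod int b) \<longleftrightarrow> [int i = r b] (mod int b)" if "b \<in> B" for b
    proof -
      have "[int (i + L) = int i] (mod int b)"
        using L(2)[OF that] by (simp add: cong_iff_dvd_diff)
      then show ?thesis by (meson cong_sym cong_trans)
    qed
    then show ?thesis by (simp add: f_def P_def)
  qed
  then have "(\<Sum>i<n. f i) \<le> (\<Sum>i<L. f i) * (real n / real L + 1)"
    using L(1) by (intro periodic_sum_bounds(1)) (auto simp: f_def)
  also have "\<dots> \<le> real (free_residues B) * (real n / real L + 1)"
    unfolding card_f using rogers by (intro mult_right_mono) auto
  finally show ?thesis
    unfolding card_f by (simp add: P_def L_def)
qed

text \<open>
  An admissible point misses one residue class for each modulus. There are \<open>period B\<close> choices of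
  these classes, a number independent of \<open>n\<close>, and once they are chosen the block is an arbitrary
  subset of the positions that avoid them.
\<close>

lemma card_blocks_admissible:
  assumes B: "finite B" "0 \<notin> B"
  shows "real (card (blocks n (admissible_shift B))) \<le>
    real (period B) * 2 powr (real (free_residues B) * (real n / real (period B) + 1))"
proof -
  define G where "G r = {i. i < n \<and> (\<forall>b\<in>B. \<not> [int i = r b] (mod int b))}" for r
  define W where "W r = {xs. length xs = n \<and> (\<forall>i<n. xs ! i \<longrightarrow> i \<in> G r)}" for r
  define R where "R = PiE B (\<lambda>b. {0..<int b})"
  have finR: "finite R" unfolding R_def using B by (intro finite_PiE) auto
  have cardR: "card R = period B"
    unfolding R_def using B by (simp add: card_PiE period_def)
  have finW: "finite (W r)" for r
    by (rule finite_subset[OF _ finite_lists_length_eq[of "UNIV :: bool set" n]])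
      (auto simp: W_def)
  have "blocks n (admissible_shift B) \<subseteq> (\<Union>r\<in>R. W r)"
  proof
    fix xs assume "xs \<in> blocks n (admissible_shift B)"
    then obtain x k where x: "x \<in> admissible_shift B" and xs: "xs = map (\<lambda>i. x (k + int i)) [0..<n]"
      by (auto simp: blocks_def)
    have "\<exists>c. b \<in> B \<longrightarrow> c \<notin> (\<lambda>n. n mod int b) ` supp x \<and> 0 \<le> c \<and> c < int b" for b
    proof (cases "b \<in> B")
      case True
      then have "card ((\<lambda>n. n mod int b) ` supp x) < card {0..<int b}"
        using x by (simp add: admissible_shift_def)
      then have "\<not> {0..<int b} \<subseteq> (\<lambda>n. n mod int b) ` supp x"
      proof (rule contrapos_pn)
        assume sub: "{0..<int b} \<subseteq> (\<lambda>n. n mod int b) ` supp x"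
        have "b \<noteq> 0" using True B(2) by metis
        then have "(\<lambda>n. n mod int b) ` supp x \<subseteq> {0..<int b}" by auto
        with sub show "\<not> card ((\<lambda>n. n mod int b) ` supp x) < card {0..<int b}" by simp
      qed
      then show ?thesis by auto
    qed simp
    then obtain c where c: "\<And>b. b \<in> B \<Longrightarrow> c b \<notin> (\<lambda>n. n mod int b) ` supp x"
      "\<And>b. b \<in> B \<Longrightarrow> 0 \<le> c b \<and> c b < int b"
      by metis
    define r where "r = restrict (\<lambda>b. (c b - k) mod int b) B"
    have "r \<in> R"
      using B by (auto simp: R_def r_def intro!: pos_mod_sign pos_mod_bound gr0I)
    moreover have "xs \<in> W r"
    proof -
      have "i \<in> G r" if i: "i < n" "x (k + int i)" for i
      proof -
        have "\<not> [int i = r b] (mod int b)" if b: "b \<in> B" for b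
        proof
          assume "[int i = r b] (mod int b)"
          then have "[int i = c b - k] (mod int b)"
            using b by (simp add: r_def cong_def)
          then have "[k + int i = k + (c b - k)] (mod int b)"
            by (intro cong_add) auto
          then have "(k + int i) mod int b = c b"
            using c(2)[OF b] by (simp add: cong_def)
          moreover have "k + int i \<in> supp x" using i by (simp add: supp_def)
          ultimately have "c b \<in> (\<lambda>n. n mod int b) ` supp x" by (metis imageI)
          then show False using c(1)[OF b] by simp
        qed
        then show ?thesis using i by (simp add: G_def)
      qed
      then show ?thesis by (simp add: W_def xs)
    qed
    ultimately show "xs \<in> (\<Union>r\<in>R. W r)" by blast
  qed
  then have "card (blocks n (admissible_shift B)) \<le> card (\<Union>r\<in>R. W r)"
    using finR finW by (intro card_mono) auto
  also have "\<dots> \<le> (\<Sum>r\<in>R. card (W r))"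
    by (rule card_UN_le[OF finR])
  finally have "real (card (blocks n (admissible_shift B))) \<le> (\<Sum>r\<in>R. real (card (W r)))"
    by (simp only: of_nat_sum[symmetric] of_nat_le_iff)
  also have "\<dots> \<le> (\<Sum>r\<in>R. 2 powr (real (free_residues B) * (real n / real (period B) + 1)))"
  proof (rule sum_mono)
    fix r
    have "card (W r) \<le> card (Pow (G r))"
    proof (rule card_inj_on_le[where f = "\<lambda>xs. {i. i < n \<and> xs ! i}"])
      show "inj_on (\<lambda>xs. {i. i < n \<and> xs ! i}) (W r)"
        by (rule inj_onI) (auto simp: W_def set_eq_iff intro: nth_equalityI)
    qed (auto simp: W_def G_def)
    then have "real (card (W r)) \<le> real (2 ^ card (G r))"
      by (simp only: of_nat_le_iff) (simp add: card_Pow G_def)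
    also have "\<dots> = 2 powr real (card (G r))" by (simp add: powr_realpow)
    also have "\<dots> \<le> 2 powr (real (free_residues B) * (real n / real (period B) + 1))"
      unfolding G_def using card_avoiding_residues[OF B] by (intro powr_mono) auto
    finally show "real (card (W r)) \<le> \<dots>" .
  qed
  also have "\<dots> = real (period B) * 2 powr (real (free_residues B) * (real n / real (period B) + 1))"
    by (simp add: cardR)
  finally show ?thesis .
qed

lemma admissible_shift_antimono:
  "B \<subseteq> B' \<Longrightarrow> admissible_shift B' \<subseteq> admissible_shift B"
  by (auto simp: admissible_shift_def)

lemma entropy_seq_admissible_le:
  assumes B: "0 \<notin> B" and n: "0 < n"
  shows "entropy_seq (admissible_shift B) n \<le> free_density (truncation B K) +
    (log 2 (real (period (truncation B K))) + real (free_residues (truncation B K))) / real n"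
proof -
  let ?B = "truncation B K"
  let ?L = "real (period ?B)" and ?C = "real (free_residues ?B)"
  have BK: "finite ?B" "0 \<notin> ?B" using truncation_simps B by auto
  have L: "0 < ?L" using period_pos[OF BK] by simp
  have "(\<lambda>_. False) \<in> admissible_shift B"
    using B by (auto simp: admissible_shift_def supp_def intro: gr0I)
  then have "blocks n (admissible_shift B) \<noteq> {}" unfolding blocks_def by blast
  then have pos: "0 < real (card (blocks n (admissible_shift B)))"
    using finite_blocks by (simp add: card_gt_0_iff)
  have "card (blocks n (admissible_shift B)) \<le> card (blocks n (admissible_shift ?B))"
    by (intro card_mono finite_blocks blocks_mono admissible_shift_antimono truncation_simps)
  then have "real (card (blocks n (admissible_shift B))) \<le>
      real (card (blocks n (admissible_shift ?B)))" by simp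
  also have "\<dots> \<le> ?L * 2 powr (?C * (real n / ?L + 1))"
    by (rule card_blocks_admissible[OF BK])
  finally have "log 2 (real (card (blocks n (admissible_shift B)))) \<le>
      log 2 (?L * 2 powr (?C * (real n / ?L + 1)))"
    using pos L by (subst log_le_cancel_iff) auto
  also have "\<dots> = log 2 ?L + ?C * (real n / ?L + 1)"
    using L by (simp add: log_mult)
  finally have "entropy_seq (admissible_shift B) n \<le> (log 2 ?L + ?C * (real n / ?L + 1)) / real n"
    unfolding entropy_seq_def by (intro divide_right_mono) auto
  also have "\<dots> = free_density ?B + (log 2 ?L + ?C) / real n"
    using n L by (simp add: free_density_def field_simps)
  finally show ?thesis .
qed

section \<open>The subshifts\<close>

text \<open>
  In this form closedness, invariance and heredity are read off directly.
\<close>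

lemma admissible_shift_iff:
  assumes "0 \<notin> B"
  shows "x \<in> admissible_shift B \<longleftrightarrow>
    (\<forall>b\<in>B. \<exists>r\<in>{0..<int b}. \<forall>n. [n = r] (mod int b) \<longrightarrow> \<not> x n)"
proof -
  have "card ((\<lambda>n. n mod int b) ` supp x) < b \<longleftrightarrow>
      (\<exists>r\<in>{0..<int b}. \<forall>n. [n = r] (mod int b) \<longrightarrow> \<not> x n)" if b: "b \<in> B" for b
  proof -
    let ?I = "(\<lambda>n. n mod int b) ` supp x"
    have "b \<noteq> 0" using b assms by metis
    then have sub: "?I \<subseteq> {0..<int b}" by auto
    have "card ?I < b \<longleftrightarrow> ?I \<subset> {0..<int b}"
    proof
      assume "card ?I < b"
      then show "?I \<subset> {0..<int b}" using sub by (auto simp: psubset_eq)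
    next
      assume "?I \<subset> {0..<int b}"
      from psubset_card_mono[OF _ this] show "card ?I < b" by simp
    qed
    also have "\<dots> \<longleftrightarrow> (\<exists>r\<in>{0..<int b}. r \<notin> ?I)" using sub by blast
    also have "\<dots> \<longleftrightarrow> (\<exists>r\<in>{0..<int b}. \<forall>n. [n = r] (mod int b) \<longrightarrow> \<not> x n)"
    proof (rule bex_cong[OF refl])
      fix r assume "r \<in> {0..<int b}"
      then have "r mod int b = r" by auto
      then show "r \<notin> ?I \<longleftrightarrow> (\<forall>n. [n = r] (mod int b) \<longrightarrow> \<not> x n)"
        by (auto simp: supp_def cong_def image_iff)
    qed
    finally show ?thesis .
  qed
  then show ?thesis by (simp add: admissible_shift_def)
qed

lemma admissible_shift_translate:
  assumes B: "0 \<notin> B" and x: "x \<in> admissible_shift B"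
  shows "shift_pow m x \<in> admissible_shift B"
  unfolding admissible_shift_iff[OF B]
proof
  fix b assume b: "b \<in> B"
  then obtain r where r: "\<And>n. [n = r] (mod int b) \<Longrightarrow> \<not> x n"
    using x unfolding admissible_shift_iff[OF B] by blast
  have b0: "0 < int b" using b B by (metis gr0I of_nat_0_less_iff)
  have "\<not> shift_pow m x n" if "[n = (r - m) mod int b] (mod int b)" for n
  proof -
    have "[n = r - m] (mod int b)" using that by (simp add: cong_def)
    then have "[n + m = r - m + m] (mod int b)" by (intro cong_add) auto
    then show ?thesis using r[of "n + m"] by (simp add: shift_pow_def)
  qed
  then show "\<exists>r\<in>{0..<int b}. \<forall>n. [n = r] (mod int b) \<longrightarrow> \<not> shift_pow m x n"
    using b0 by (intro bexI[of _ "(r - m) mod int b"]) auto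
qed

lemma closed_admissible_shift:
  assumes B: "0 \<notin> B"
  shows "closed (admissible_shift B)"
proof -
  have coord: "closed {x :: bseq. \<not> x n}" for n
  proof -
    have "closed ((\<lambda>x :: bseq. x n) -` {False})"
      by (intro closed_vimage) (auto intro!: continuous_intros)
    then show ?thesis by (simp add: vimage_def)
  qed
  have "admissible_shift B =
      (\<Inter>b\<in>B. \<Union>r\<in>{0..<int b}. \<Inter>n\<in>{n. [n = r] (mod int b)}. {x. \<not> x n})"
    by (rule set_eqI) (simp add: admissible_shift_iff[OF B])
  then show ?thesis
    by (auto intro!: closed_INT closed_UN coord)
qed

lemma subshift_admissible_shift:
  assumes B: "0 \<notin> B"
  shows "subshift (admissible_shift B)"
proof -
  have shift: "shift x = shift_pow 1 x" and inverse: "shift (shift_pow (- 1) x) = x" for x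
    by (simp_all add: shift_def shift_pow_def)
  have "shift ` admissible_shift B = admissible_shift B"
  proof (intro equalityI subsetI)
    fix x assume "x \<in> admissible_shift B"
    then show "x \<in> shift ` admissible_shift B"
      by (intro image_eqI[of x shift "shift_pow (- 1) x"] inverse[symmetric] admissible_shift_translate[OF B])
  next
    fix x assume "x \<in> shift ` admissible_shift B"
    then show "x \<in> admissible_shift B"
      unfolding shift using admissible_shift_translate[OF B] by blast
  qed
  then show ?thesis
    using closed_admissible_shift[OF B] by (simp add: subshift_def)
qed

lemma hereditary_admissible_shift:
  assumes B: "0 \<notin> B"
  shows "hereditary (admissible_shift B)"
  unfolding hereditary_def
proof (intro ballI allI impI)
  fix x y :: bseq assume x: "x \<in> admissible_shift B" and "y \<le> x"
  then have "y n \<Longrightarrow> x n" for n by (auto simp: le_fun_def)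
  then show "y \<in> admissible_shift B"
    using x unfolding admissible_shift_iff[OF B] by blast
qed

lemma eta_admissible:
  assumes B: "0 \<notin> B"
  shows "eta B \<in> admissible_shift B"
  unfolding admissible_shift_iff[OF B]
proof
  fix b assume b: "b \<in> B"
  then have "0 < b" using B by (metis gr0I)
  moreover have "\<not> eta B n" if "[n = 0] (mod int b)" for n
    using that b by (auto simp: eta_def mem_free_set cong_0_iff)
  ultimately show "\<exists>r\<in>{0..<int b}. \<forall>n. [n = r] (mod int b) \<longrightarrow> \<not> eta B n"
    by (intro bexI[of _ 0]) auto
qed

lemma X_eta_hered_subset_admissible:
  assumes B: "0 \<notin> B"
  shows "X_eta_hered B \<subseteq> admissible_shift B"
  unfolding X_eta_hered_def
proof (rule hereditary_closure_least)
  show "X_eta B \<subseteq> admissible_shift B"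
    unfolding X_eta_def orbit_closure_def
    using closed_admissible_shift[OF B] admissible_shift_translate[OF B eta_admissible[OF B]]
    by (intro closure_minimal image_subsetI)
qed (rule subshift_admissible_shift[OF B] hereditary_admissible_shift[OF B])+

lemma eta_in_X_eta_hered: "eta B \<in> X_eta_hered B"
proof -
  have "eta B \<in> range (\<lambda>m. shift_pow m (eta B))"
    by (rule range_eqI[of _ _ 0]) (simp add: shift_pow_def)
  then have "eta B \<in> X_eta B"
    unfolding X_eta_def orbit_closure_def by (rule subsetD[OF closure_subset])
  then show ?thesis
    unfolding X_eta_hered_def by (rule subsetD[OF subset_hereditary_closure])
qed

text \<open>
  The estimates from below use only heredity and \<open>eta B\<close>, those from above only admissibility;
  both subshifts of the main theorem lie in this range.
\<close>

lemma entropy_seq_tendsto_limit_density: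
  assumes B: "0 \<notin> B" and X: "hereditary X" "eta B \<in> X" "X \<subseteq> admissible_shift B"
  shows "entropy_seq X \<longlonglongrightarrow> limit_density B"
proof (rule order_tendstoI)
  fix a assume "a < limit_density B"
  then show "eventually (\<lambda>n. a < entropy_seq X n) sequentially"
    by (intro eventually_mono[OF eventually_gt_at_top[of 0]])
      (rule less_le_trans[OF _ limit_density_le_entropy_seq[OF B X(1,2)]])
next
  fix a assume "limit_density B < a"
  then obtain K where K: "free_density (truncation B K) < a"
    by (rule limit_density_approx[OF B])
  define C where "C = log 2 (real (period (truncation B K))) + real (free_residues (truncation B K))"
  have le: "entropy_seq X n \<le> free_density (truncation B K) + C / real n" if n: "0 < n" for n
  proof -
    have "0 < real (card (blocks n X))"
      using card_blocks_hereditary[OF X(1,2), of n] by (rule less_le_trans[rotated]) simp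
    moreover have "card (blocks n X) \<le> card (blocks n (admissible_shift B))"
      by (intro card_mono finite_blocks blocks_mono X)
    ultimately have "entropy_seq X n \<le> entropy_seq (admissible_shift B) n"
      unfolding entropy_seq_def by (intro divide_right_mono) auto
    also have "\<dots> \<le> free_density (truncation B K) + C / real n"
      unfolding C_def by (rule entropy_seq_admissible_le[OF B n])
    finally show ?thesis .
  qed
  have "(\<lambda>n. free_density (truncation B K) + C / real n) \<longlonglongrightarrow> free_density (truncation B K) + 0"
    by (intro tendsto_intros lim_const_over_n)
  then have "eventually (\<lambda>n. free_density (truncation B K) + C / real n < a) sequentially"
    using K by (intro order_tendstoD(2)) auto
  then show "eventually (\<lambda>n. entropy_seq X n < a) sequentially"
    using eventually_gt_at_top[of 0] by eventually_elim (rule le_less_trans[OF le])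
qed

theorem proposition11:
  fixes B :: "nat set"
  assumes "0 \<notin> B"
  shows "convergent (entropy_seq (X_eta_hered B)) \<and>
         convergent (entropy_seq (admissible_shift B)) \<and>
         convergent (log_density_seq (free_set B)) \<and>
         top_entropy (X_eta_hered B) = top_entropy (admissible_shift B) \<and>
         top_entropy (admissible_shift B) = log_density (free_set B)"
proof -
  have "entropy_seq (X_eta_hered B) \<longlonglongrightarrow> limit_density B"
    using assms hereditary_hereditary_closure
    by (intro entropy_seq_tendsto_limit_density eta_in_X_eta_hered X_eta_hered_subset_admissible)
      (simp_all add: X_eta_hered_def)
  moreover have "entropy_seq (admissible_shift B) \<longlonglongrightarrow> limit_density B"
    using assms
    by (intro entropy_seq_tendsto_limit_density hereditary_admissible_shift eta_admissible) auto
  moreover have "log_density_seq (free_set B) \<longlonglongrightarrow> limit_density B"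
    by (rule davenport_erdos[OF assms])
  ultimately show ?thesis
    unfolding top_entropy_def log_density_def by (auto simp: limI intro: convergentI)
qed

end
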